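(* Let $\mathcal{M}$ be a Markov automaton with underlying MDP $\mathcal{M}_u$, let $\mathbb{O}=(\mathbb{P}(\Diamond G_1),\dots,\mathbb{P}(\Diamond G_d))$ be untimed reachability objectives, $\rhd\in\{<,\le,>,\ge\}^d$ and $p\in\mathbb{R}^d$. Then $\mathrm{achieve}^{\mathcal{M}}(\mathbb{O}\rhd p)$ holds if and only if $\mathrm{achieve}^{\mathcal{M}_u}(\mathbb{O}\rhd p)$ holds.
   Context: A Markov automaton (MA) is a tuple $\mathcal{M}=(S,\mathit{Act},\to,s_0,\{\rho_1,\dots,\rho_\ell\})$ with $S$ a finite set of states, $s_0$ the initial state, $\mathit{Act}$ a finite action set with distinguished $\bot$ and $\mathit{Act}\cap\mathbb{R}_{\ge0}=\emptyset$, transitions $\to\subseteq S\times(\mathit{Act}\,\dot\cup\,\mathbb{R}_{>0})\times\mathrm{Dist}(S)$ with at most one rate-labelled (Markovian) transition per state, reward functions $\rho_i\colon S\,\dot\cup\,(S\times\mathit{Act})\to\mathbb{R}_{\ge0}$. Standing assumptions: action-determinism, every state has an outgoing transition, maximal progress (so $S=PS\,\dot\cup\,MS$, probabilistic and Markovian states), non-Zenoness. $E(s)$ is the exit rate of $s\in MS$; $P(s,\alpha,s')$ the transition probability ($\alpha=\bot$ for Markovian transitions). Paths of $\mathcal{M}$: $s_0\xrightarrow{\kappa_0}s_1\cdots$ with $\kappa_i$ an action at $PS$ and a sojourn time in $\mathbb{R}_{\ge0}$ at $MS$. A generic scheduler $\sigma$ of $\mathcal{M}$ maps each finite path (with sojourn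 times) measurably to a distribution over enabled actions of its last state; it induces $\Pr^{\mathcal{M}}_\sigma$ on infinite paths (probabilistic steps by $\sigma$ and $P$; at $s\in MS$ the sojourn time has density $E(s)e^{-E(s)t}$ and the successor is drawn by $P(s,\bot,\cdot)$). An MDP is $(S,\mathit{Act},P,s_0,\dots)$ with $\sum_{s'}P(s,\alpha,s')\in\{0,1\}$; its schedulers map finite paths $s_0\xrightarrow{\alpha_0}\cdots s_n$ to distributions over enabled actions (history-dependent, randomized), and the probability of a finite path is $\prod_i\sigma(\text{prefix}_i,\alpha_i)P(s_i,\alpha_i,s_{i+1})$. The underlying MDP of $\mathcal{M}$ is $\mathcal{M}_u=(S,\mathit{Act},P,s_0,\dots)$ (timing forgotten; Markovian transitions become $\bot$-labelled). $\mathbb{P}(\Diamond G)$ is the probability of eventually visiting $G\subseteq S$. For a model $\mathcal{N}\in\{\mathcal{M},\mathcal{M}_u\}$, $\mathrm{achieve}^{\mathcal{N}}(\mathbb{O}\rhd p)$ holds iff some scheduler of $\mathcal{N}$ (generic for $\mathcal{M}$) gives $\Pr(\Diamond G_i)\rhd_ip_i$ for all $i$. *)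

theory Defs
  imports "HOL-Probability.Probability"
begin

text \<open>
  The finite sets of states and actions are the types \<^typ>\<open>'s::finite\<close> and \<^typ>\<open>'a::finite\<close>.
  The disjoint union of actions and real numbers is \<^typ>\<open>'a + real\<close>.

  A finite path \<open>s\<^sub>0 \<kappa>\<^sub>0 s\<^sub>1 \<kappa>\<^sub>1 \<dots> s\<^sub>n\<close> is the pair \<open>([(s\<^sub>0,\<kappa>\<^sub>0), \<dots>, (s\<^sub>n\<^sub>-\<^sub>1,\<kappa>\<^sub>n\<^sub>-\<^sub>1)], s\<^sub>n)\<close>, and an
  infinite path \<open>s\<^sub>0 \<kappa>\<^sub>0 s\<^sub>1 \<kappa>\<^sub>1 \<dots>\<close> is the function \<open>\<lambda>i. (s\<^sub>i, \<kappa>\<^sub>i)\<close>.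
\<close>

type_synonym ('s, 'k) fpath = "('s \<times> 'k) list \<times> 's"
type_synonym ('s, 'k) ipath = "nat \<Rightarrow> 's \<times> 'k"

text \<open>
  The measure on sequences given by the Ionescu-Tulcea theorem: coordinate \<open>n\<close> is distributed
  according to \<open>K n \<omega>\<close>, where \<open>\<omega>\<close> contains the coordinates below \<open>n\<close>.
\<close>

definition trajectory_measure ::
    "'x measure \<Rightarrow> (nat \<Rightarrow> (nat \<Rightarrow> 'x) \<Rightarrow> 'x measure) \<Rightarrow> (nat \<Rightarrow> 'x) measure" where
  "trajectory_measure X K = projective_family.lim UNIV (Ionescu_Tulcea.CI K (\<lambda>_. X)) (\<lambda>_. X)"

text \<open>
  The case \<open>return_pmf s\<close> only concerns disabled actions, which schedulers never choose.
\<close>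

definition succ_pmf :: "('s::finite \<Rightarrow> 'a \<Rightarrow> 's \<Rightarrow> real) \<Rightarrow> 's \<Rightarrow> 'a \<Rightarrow> 's pmf" where
  "succ_pmf P s \<alpha> = (if (\<Sum>s'\<in>UNIV. P s \<alpha> s') = 1 then embed_pmf (P s \<alpha>) else return_pmf s)"

definition reaches :: "'s set \<Rightarrow> ('s, 'k) ipath \<Rightarrow> bool" where
  "reaches G \<omega> \<longleftrightarrow> (\<exists>n. fst (\<omega> n) \<in> G)"


section \<open>Markov decision processes\<close>

record ('s, 'a) mdp =
  mdp_P :: "'s \<Rightarrow> 'a \<Rightarrow> 's \<Rightarrow> real"
  mdp_init :: 's

definition is_mdp :: "('s::finite, 'a::finite) mdp \<Rightarrow> bool" where
  "is_mdp D \<longleftrightarrow> (\<forall>s \<alpha> s'. mdp_P D s \<alpha> s' \<in> {0..1}) \<and> (\<forall>s \<alpha>. (\<Sum>s'\<in>UNIV. mdp_P D s \<alpha> s') \<in> {0, 1})"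

definition mdp_enabled :: "('s::finite, 'a::finite) mdp \<Rightarrow> 's \<Rightarrow> 'a set" where
  "mdp_enabled D s = {\<alpha>. (\<Sum>s'\<in>UNIV. mdp_P D s \<alpha> s') = 1}"

inductive mdp_fpath :: "('s::finite, 'a::finite) mdp \<Rightarrow> ('s, 'a) fpath \<Rightarrow> bool" for D where
  start: "mdp_fpath D ([], mdp_init D)"
| step: "mdp_fpath D (h, s) \<Longrightarrow> mdp_P D s \<alpha> s' > 0 \<Longrightarrow> mdp_fpath D (h @ [(s, \<alpha>)], s')"

definition mdp_scheduler ::
    "('s::finite, 'a::finite) mdp \<Rightarrow> (('s, 'a) fpath \<Rightarrow> 'a pmf) \<Rightarrow> bool" where
  "mdp_scheduler D \<sigma> \<longleftrightarrow> (\<forall>\<pi>. mdp_fpath D \<pi> \<longrightarrow> set_pmf (\<sigma> \<pi>) \<subseteq> mdp_enabled D (snd \<pi>))"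

definition mdp_next :: "('s::finite, 'a::finite) mdp \<Rightarrow> nat \<Rightarrow> ('s, 'a) ipath \<Rightarrow> 's pmf" where
  "mdp_next D n \<omega> =
     (case n of 0 \<Rightarrow> return_pmf (mdp_init D)
      | Suc m \<Rightarrow> succ_pmf (mdp_P D) (fst (\<omega> m)) (snd (\<omega> m)))"

definition mdp_kernel ::
    "('s::finite, 'a::finite) mdp \<Rightarrow> (('s, 'a) fpath \<Rightarrow> 'a pmf) \<Rightarrow>
     nat \<Rightarrow> ('s, 'a) ipath \<Rightarrow> ('s \<times> 'a) measure" where
  "mdp_kernel D \<sigma> n \<omega> =
     measure_pmf (bind_pmf (mdp_next D n \<omega>) (\<lambda>s. map_pmf (Pair s) (\<sigma> (map \<omega> [0..<n], s))))"

definition mdp_measure ::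
    "('s::finite, 'a::finite) mdp \<Rightarrow> (('s, 'a) fpath \<Rightarrow> 'a pmf) \<Rightarrow> ('s, 'a) ipath measure" where
  "mdp_measure D \<sigma> = trajectory_measure (count_space UNIV) (mdp_kernel D \<sigma>)"

definition mdp_reach_prob ::
    "('s::finite, 'a::finite) mdp \<Rightarrow> (('s, 'a) fpath \<Rightarrow> 'a pmf) \<Rightarrow> 's set \<Rightarrow> real" where
  "mdp_reach_prob D \<sigma> G =
     measure (mdp_measure D \<sigma>) {\<omega> \<in> space (mdp_measure D \<sigma>). reaches G \<omega>}"

definition mdp_achieve ::
    "('s::finite, 'a::finite) mdp \<Rightarrow> nat \<Rightarrow> (nat \<Rightarrow> 's set) \<Rightarrow>
     (nat \<Rightarrow> real \<Rightarrow> real \<Rightarrow> bool) \<Rightarrow> (nat \<Rightarrow> real) \<Rightarrow> bool" where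
  "mdp_achieve D d G rel p \<longleftrightarrow>
     (\<exists>\<sigma>. mdp_scheduler D \<sigma> \<and> (\<forall>i\<in>{1..d}. rel i (mdp_reach_prob D \<sigma> (G i)) (p i)))"


section \<open>Markov automata\<close>

record ('s, 'a) ma =
  ma_trans :: "('s \<times> ('a + real) \<times> 's pmf) set"
  ma_init :: 's
  bot_act :: 'a
  ma_rewards :: "('s + 's \<times> 'a \<Rightarrow> real) list"

definition prob_states :: "('s, 'a) ma \<Rightarrow> 's set" where
  "prob_states M = {s. \<exists>\<alpha> \<mu>. (s, Inl \<alpha>, \<mu>) \<in> ma_trans M}"

definition markov_states :: "('s, 'a) ma \<Rightarrow> 's set" where
  "markov_states M = {s. \<exists>r \<mu>. (s, Inr r, \<mu>) \<in> ma_trans M}"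

definition exit_rate :: "('s, 'a) ma \<Rightarrow> 's \<Rightarrow> real" where
  "exit_rate M s = (THE r. \<exists>\<mu>. (s, Inr r, \<mu>) \<in> ma_trans M)"

definition act_trans :: "('s, 'a) ma \<Rightarrow> 's \<Rightarrow> 'a \<Rightarrow> 's pmf \<Rightarrow> bool" where
  "act_trans M s \<alpha> \<mu> \<longleftrightarrow>
     (s, Inl \<alpha>, \<mu>) \<in> ma_trans M \<or> \<alpha> = bot_act M \<and> (\<exists>r. (s, Inr r, \<mu>) \<in> ma_trans M)"

definition ma_P :: "('s, 'a) ma \<Rightarrow> 's \<Rightarrow> 'a \<Rightarrow> 's \<Rightarrow> real" where
  "ma_P M s \<alpha> s' = (if \<exists>\<mu>. act_trans M s \<alpha> \<mu> then pmf (THE \<mu>. act_trans M s \<alpha> \<mu>) s' else 0)"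

definition ma_enabled :: "('s, 'a) ma \<Rightarrow> 's \<Rightarrow> 'a set" where
  "ma_enabled M s = {\<alpha>. \<exists>\<mu>. act_trans M s \<alpha> \<mu>}"

text \<open>All requirements on a Markov automaton except for non-Zenoness.\<close>

definition ma_wf :: "('s::finite, 'a::finite) ma \<Rightarrow> bool" where
  "ma_wf M \<longleftrightarrow>
     (\<forall>s r \<mu>. (s, Inr r, \<mu>) \<in> ma_trans M \<longrightarrow> r > 0) \<and>
     (\<forall>s r r' \<mu> \<mu>'. (s, Inr r, \<mu>) \<in> ma_trans M \<longrightarrow> (s, Inr r', \<mu>') \<in> ma_trans M \<longrightarrow> r = r' \<and> \<mu> = \<mu>') \<and>
     (\<forall>\<rho>\<in>set (ma_rewards M). \<forall>x. \<rho> x \<ge> 0) \<and>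
     \<comment> \<open>action-determinism\<close>
     (\<forall>s \<alpha> \<mu> \<mu>'. (s, Inl \<alpha>, \<mu>) \<in> ma_trans M \<longrightarrow> (s, Inl \<alpha>, \<mu>') \<in> ma_trans M \<longrightarrow> \<mu> = \<mu>') \<and>
     \<comment> \<open>no terminal states\<close>
     prob_states M \<union> markov_states M = UNIV \<and>
     \<comment> \<open>maximal progress\<close>
     prob_states M \<inter> markov_states M = {}"

inductive ma_fpath :: "('s::finite, 'a::finite) ma \<Rightarrow> ('s, 'a + real) fpath \<Rightarrow> bool" for M where
  start: "ma_fpath M ([], ma_init M)"
| action: "ma_fpath M (h, s) \<Longrightarrow> s \<in> prob_states M \<Longrightarrow> ma_P M s \<alpha> s' > 0 \<Longrightarrow>
     ma_fpath M (h @ [(s, Inl \<alpha>)], s')"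
| delay: "ma_fpath M (h, s) \<Longrightarrow> s \<in> markov_states M \<Longrightarrow> t \<ge> 0 \<Longrightarrow> ma_P M s (bot_act M) s' > 0 \<Longrightarrow>
     ma_fpath M (h @ [(s, Inr t)], s')"

definition label_space :: "('a::finite + real) measure" where
  "label_space = sigma UNIV ({Inl ` A |A. True} \<union> {Inr ` B |B. B \<in> sets borel})"

definition ma_step_space :: "('s::finite \<times> ('a::finite + real)) measure" where
  "ma_step_space = count_space UNIV \<Otimes>\<^sub>M label_space"

text \<open>
  A generic scheduler is a total function here: its values outside \<^const>\<open>ma_fpath\<close> are irrelevant,
  and measurability is required on all sequences of the shape of a finite path. The finite paths
  form a measurable subset of these sequences, so every measurable function on them extends.
\<close>

definition ma_scheduler ::
    "('s::finite, 'a::finite) ma \<Rightarrow> (('s, 'a + real) fpath \<Rightarrow> 'a pmf) \<Rightarrow> bool" where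
  "ma_scheduler M \<sigma> \<longleftrightarrow>
     (\<forall>\<pi>. ma_fpath M \<pi> \<longrightarrow> set_pmf (\<sigma> \<pi>) \<subseteq> ma_enabled M (snd \<pi>)) \<and>
     (\<forall>n s \<alpha>. (\<lambda>\<omega>. pmf (\<sigma> (map \<omega> [0..<n], s)) \<alpha>)
        \<in> borel_measurable (PiM {0..<n} (\<lambda>_. ma_step_space)))"

definition ma_next :: "('s::finite, 'a::finite) ma \<Rightarrow> nat \<Rightarrow> ('s, 'a + real) ipath \<Rightarrow> 's pmf" where
  "ma_next M n \<omega> =
     (case n of 0 \<Rightarrow> return_pmf (ma_init M)
      | Suc m \<Rightarrow> succ_pmf (ma_P M) (fst (\<omega> m))
          (case snd (\<omega> m) of Inl \<alpha> \<Rightarrow> \<alpha> | Inr t \<Rightarrow> bot_act M))"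

definition ma_label ::
    "('s::finite, 'a::finite) ma \<Rightarrow> (('s, 'a + real) fpath \<Rightarrow> 'a pmf) \<Rightarrow>
     ('s, 'a + real) fpath \<Rightarrow> ('a + real) measure" where
  "ma_label M \<sigma> \<pi> =
     (if snd \<pi> \<in> markov_states M
      then distr (density lborel (exponential_density (exit_rate M (snd \<pi>)))) label_space Inr
      else distr (measure_pmf (\<sigma> \<pi>)) label_space Inl)"

definition ma_kernel ::
    "('s::finite, 'a::finite) ma \<Rightarrow> (('s, 'a + real) fpath \<Rightarrow> 'a pmf) \<Rightarrow>
     nat \<Rightarrow> ('s, 'a + real) ipath \<Rightarrow> ('s \<times> ('a + real)) measure" where
  "ma_kernel M \<sigma> n \<omega> =
     measure_pmf (ma_next M n \<omega>) \<bind>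
       (\<lambda>s. distr (ma_label M \<sigma> (map \<omega> [0..<n], s)) ma_step_space (Pair s))"

definition ma_measure ::
    "('s::finite, 'a::finite) ma \<Rightarrow> (('s, 'a + real) fpath \<Rightarrow> 'a pmf) \<Rightarrow>
     ('s, 'a + real) ipath measure" where
  "ma_measure M \<sigma> = trajectory_measure ma_step_space (ma_kernel M \<sigma>)"

definition duration :: "'a + real \<Rightarrow> real" where
  "duration \<kappa> = (case \<kappa> of Inl \<alpha> \<Rightarrow> 0 | Inr t \<Rightarrow> t)"

definition non_zeno :: "('s::finite, 'a::finite) ma \<Rightarrow> bool" where
  "non_zeno M \<longleftrightarrow>
     (\<forall>\<sigma>. ma_scheduler M \<sigma> \<longrightarrow>
        (AE \<omega> in ma_measure M \<sigma>. filterlim (\<lambda>n. \<Sum>i<n. duration (snd (\<omega> i))) at_top sequentially))"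

definition markov_automaton :: "('s::finite, 'a::finite) ma \<Rightarrow> bool" where
  "markov_automaton M \<longleftrightarrow> ma_wf M \<and> non_zeno M"

definition ma_reach_prob ::
    "('s::finite, 'a::finite) ma \<Rightarrow> (('s, 'a + real) fpath \<Rightarrow> 'a pmf) \<Rightarrow> 's set \<Rightarrow> real" where
  "ma_reach_prob M \<sigma> G =
     measure (ma_measure M \<sigma>) {\<omega> \<in> space (ma_measure M \<sigma>). reaches G \<omega>}"

definition ma_achieve ::
    "('s::finite, 'a::finite) ma \<Rightarrow> nat \<Rightarrow> (nat \<Rightarrow> 's set) \<Rightarrow>
     (nat \<Rightarrow> real \<Rightarrow> real \<Rightarrow> bool) \<Rightarrow> (nat \<Rightarrow> real) \<Rightarrow> bool" where
  "ma_achieve M d G rel p \<longleftrightarrow>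
     (\<exists>\<sigma>. ma_scheduler M \<sigma> \<and> (\<forall>i\<in>{1..d}. rel i (ma_reach_prob M \<sigma> (G i)) (p i)))"

definition underlying_mdp :: "('s, 'a) ma \<Rightarrow> ('s, 'a) mdp" where
  "underlying_mdp M = \<lparr>mdp_P = ma_P M, mdp_init = ma_init M\<rparr>"


section \<open>Well-definedness\<close>

text \<open>
  The kernels satisfy the hypotheses of the Ionescu-Tulcea theorem, so the path measures above are
  the intended ones.
\<close>

lemma mdp_Ionescu_Tulcea: "Ionescu_Tulcea (mdp_kernel D \<sigma>) (\<lambda>_. count_space UNIV)"
proof (rule Ionescu_Tulcea.intro)
  fix i :: nat
  have "sets (PiM {0..<i} (\<lambda>_. count_space (UNIV::('a \<times> 'b) set))) =
      sets (count_space (PiE {0..<i} (\<lambda>_. UNIV)))"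
    by (intro arg_cong[where f=sets] count_space_PiM_finite) auto
  then show "mdp_kernel D \<sigma> i \<in> measurable (PiM {0..<i} (\<lambda>_. count_space UNIV)) (subprob_algebra (count_space UNIV))"
    by (subst measurable_cong_sets[OF _ refl], assumption)
      (auto simp: mdp_kernel_def[abs_def] space_subprob_algebra intro!: prob_space_imp_subprob_space measure_pmf.prob_space_axioms)
qed (simp add: mdp_kernel_def measure_pmf.prob_space_axioms)

lemma space_label[simp]: "space label_space = UNIV"
  unfolding label_space_def by (simp add: space_measure_of_conv)

lemma sets_label_gen: "sets label_space = sigma_sets UNIV ({Inl ` A |A. True} \<union> {Inr ` B |B. B \<in> sets borel})"
  unfolding label_space_def by simp

lemma measurable_Inl[measurable]: "Inl \<in> measurable (count_space UNIV) label_space"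
  by simp

lemma measurable_Inr[measurable]: "Inr \<in> measurable borel label_space"
  unfolding label_space_def
proof (rule measurable_measure_of)
  fix y :: "('a + real) set" assume "y \<in> {Inl ` A |A. True} \<union> {Inr ` B |B. B \<in> sets borel}"
  then show "Inr -` y \<inter> space borel \<in> sets borel"
    by (auto simp: vimage_def image_iff)
qed auto

lemma ma_P_enabled:
  assumes "ma_wf M" "act_trans M s a \<mu>"
  shows "ma_P M s a = pmf \<mu>"
proof -
  have "\<mu>' = \<mu>" if "act_trans M s a \<mu>'" for \<mu>'
    using assms that unfolding ma_wf_def act_trans_def prob_states_def markov_states_def by blast
  then have "(THE \<mu>. act_trans M s a \<mu>) = \<mu>" using assms by blast
  then show ?thesis using assms(2) by (auto simp: ma_P_def fun_eq_iff)
qed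

lemma exit_rate_eq:
  assumes "ma_wf M" "(s, Inr r, \<mu>) \<in> ma_trans M"
  shows "exit_rate M s = r"
  unfolding exit_rate_def
proof (rule the_equality)
  fix r' assume "\<exists>\<mu>. (s, Inr r', \<mu>) \<in> ma_trans M"
  moreover have "\<forall>s r r' \<mu> \<mu>'. (s, Inr r, \<mu>) \<in> ma_trans M \<longrightarrow> (s, Inr r', \<mu>') \<in> ma_trans M \<longrightarrow> r = r' \<and> \<mu> = \<mu>'"
    using assms(1) unfolding ma_wf_def by (elim conjE)
  ultimately show "r' = r" using assms(2) by metis
qed (use assms in blast)

lemma exit_rate_pos: "ma_wf M \<Longrightarrow> s \<in> markov_states M \<Longrightarrow> exit_rate M s > 0"
proof -
  assume wf: "ma_wf M" and "s \<in> markov_states M"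
  then obtain r \<mu> where t: "(s, Inr r, \<mu>) \<in> ma_trans M" by (auto simp: markov_states_def)
  moreover have "\<forall>s r \<mu>. (s, Inr r, \<mu>) \<in> ma_trans M \<longrightarrow> r > 0"
    using wf unfolding ma_wf_def by (elim conjE)
  ultimately have "r > 0" by metis
  with exit_rate_eq[OF wf t] show ?thesis by simp
qed

lemma is_mdp_underlying:
  assumes "ma_wf M" shows "is_mdp (underlying_mdp M)"
proof -
  have "ma_P M s a s' \<in> {0..1}" "(\<Sum>s'\<in>UNIV. ma_P M s a s') \<in> {0, 1}" for s a s'
  proof -
    show "ma_P M s a s' \<in> {0..1}" by (auto simp: ma_P_def pmf_le_1)
    show "(\<Sum>s'\<in>UNIV. ma_P M s a s') \<in> {0, 1}" 
      by (cases "\<exists>\<mu>. act_trans M s a \<mu>") (simp_all add: ma_P_def sum_pmf_eq_1)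
  qed
  then show ?thesis unfolding is_mdp_def underlying_mdp_def by auto
qed

lemma enabled_underlying: 
  assumes "ma_wf M" shows "mdp_enabled (underlying_mdp M) s = ma_enabled M s"
  unfolding mdp_enabled_def ma_enabled_def underlying_mdp_def
proof (intro Collect_cong)
  fix a show "((\<Sum>s'\<in>UNIV. mdp_P \<lparr>mdp_P = ma_P M, mdp_init = ma_init M\<rparr> s a s') = 1) = (\<exists>\<mu>. act_trans M s a \<mu>)"
    by (cases "\<exists>\<mu>. act_trans M s a \<mu>") (simp_all add: ma_P_def sum_pmf_eq_1)
qed

lemma ma_label_prob: assumes "ma_wf M" shows "prob_space (ma_label M \<sigma> \<pi>)"
proof (cases "snd \<pi> \<in> markov_states M")
  case True
  have "prob_space (distr (density lborel (exponential_density (exit_rate M (snd \<pi>)))) label_space Inr)"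
    using True by (intro prob_space.prob_space_distr prob_space_exponential_density exit_rate_pos assms) auto
  then show ?thesis using True by (simp add: ma_label_def)
next
  case False
  have "prob_space (distr (measure_pmf (\<sigma> \<pi>)) label_space Inl)"
    by (rule prob_space.prob_space_distr[OF measure_pmf.prob_space_axioms]) simp
  then show ?thesis using False by (simp add: ma_label_def)
qed

lemma sets_ma_label[simp]: "sets (ma_label M \<sigma> \<pi>) = sets label_space"
  by (simp add: ma_label_def)

lemma ma_label_meas:
  assumes "ma_wf M" "ma_scheduler M \<sigma>"
  shows "(\<lambda>\<omega>. ma_label M \<sigma> (map \<omega> [0..<n], s)) \<in> measurable (PiM {0..<n} (\<lambda>_. ma_step_space)) (subprob_algebra label_space)"
proof (cases "s \<in> markov_states M")
  case True
  let ?D = "ma_label M \<sigma> ([], s)"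
  have "?D \<in> space (subprob_algebra label_space)"
    using prob_space_imp_subprob_space[OF ma_label_prob[OF assms(1)]] by (simp add: space_subprob_algebra)
  moreover have "(\<lambda>\<omega>. ma_label M \<sigma> (map \<omega> [0..<n], s)) = (\<lambda>_. ?D)"
    using True by (simp add: ma_label_def)
  ultimately show ?thesis by simp
next
  case False
  have m[measurable]: "(\<lambda>\<omega>. pmf (\<sigma> (map \<omega> [0..<n], s)) \<alpha>) \<in> borel_measurable (PiM {0..<n} (\<lambda>_. ma_step_space))" for \<alpha>
    using assms(2) unfolding ma_scheduler_def by blast
  show ?thesis
  proof (rule measurable_subprob_algebra)
    fix A :: "('b + real) set" assume A: "A \<in> sets label_space"
    have "emeasure (ma_label M \<sigma> (map \<omega> [0..<n], s)) A = (\<Sum>\<alpha>\<in>Inl -` A. ennreal (pmf (\<sigma> (map \<omega> [0..<n], s)) \<alpha>))" for \<omega>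
      using False A by (simp add: ma_label_def emeasure_distr emeasure_measure_pmf_finite)
    then show "(\<lambda>\<omega>. emeasure (ma_label M \<sigma> (map \<omega> [0..<n], s)) A) \<in> borel_measurable (PiM {0..<n} (\<lambda>_. ma_step_space))"
      by simp
  qed (auto intro!: prob_space_imp_subprob_space ma_label_prob assms)
qed

lemma ma_Ionescu_Tulcea:
  assumes "ma_wf M" "ma_scheduler M \<sigma>"
  shows "Ionescu_Tulcea (ma_kernel M \<sigma>) (\<lambda>_. ma_step_space)"
proof (rule Ionescu_Tulcea.intro)
  fix i :: nat
  let ?X = "PiM {0..<i} (\<lambda>_. ma_step_space :: ('a \<times> ('b + real)) measure)"
  have lab[measurable]: "(\<lambda>x. case x of Inl \<alpha> \<Rightarrow> \<alpha> | Inr t \<Rightarrow> bot_act M) \<in> measurable label_space (count_space UNIV)"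
  proof (rule measurableI)
    fix A :: "'b set"
    have "(\<lambda>x. case x of Inl \<alpha> \<Rightarrow> \<alpha> | Inr t \<Rightarrow> bot_act M) -` A = Inl ` A \<union> (if bot_act M \<in> A then Inr ` UNIV else {})"
    proof (rule set_eqI)
      fix x show "x \<in> (\<lambda>x. case x of Inl \<alpha> \<Rightarrow> \<alpha> | Inr t \<Rightarrow> bot_act M) -` A \<longleftrightarrow> x \<in> Inl ` A \<union> (if bot_act M \<in> A then Inr ` UNIV else {})"
        by (cases x) auto
    qed
    also have "\<dots> \<in> sets label_space"
    proof (rule sets.Un)
      show "Inl ` A \<in> sets (label_space :: ('b + real) measure)"
        unfolding sets_label_gen by (intro sigma_sets.Basic UnI1 CollectI exI[of _ A]) simp
      have "Inr ` UNIV \<in> sets (label_space :: ('b + real) measure)"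
        unfolding sets_label_gen by (intro sigma_sets.Basic UnI2 CollectI exI[of _ UNIV]) simp
      then show "(if bot_act M \<in> A then Inr ` UNIV else {}) \<in> sets (label_space :: ('b + real) measure)"
        by simp
    qed
    finally show "(\<lambda>x. case x of Inl \<alpha> \<Rightarrow> \<alpha> | Inr t \<Rightarrow> bot_act M) -` A \<inter> space label_space \<in> sets label_space" by simp
  qed simp
  have nxt: "ma_next M i \<in> measurable ?X (count_space UNIV)"
  proof (cases i)
    case 0 then show ?thesis by (simp add: ma_next_def[abs_def])
  next
    case (Suc m)
    have [measurable]: "(\<lambda>\<omega>. \<omega> m) \<in> measurable ?X ma_step_space"
      using Suc by (auto intro!: measurable_component_singleton)
    have [measurable]: "fst \<in> measurable (ma_step_space :: ('a \<times> ('b + real)) measure) (count_space UNIV)" "snd \<in> measurable (ma_step_space :: ('a \<times> ('b + real)) measure) label_space"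
      by (auto simp: ma_step_space_def)
    have "(\<lambda>\<omega>. (\<lambda>s \<omega>. succ_pmf (ma_P M) s (case snd (\<omega> m) of Inl \<alpha> \<Rightarrow> \<alpha> | Inr t \<Rightarrow> bot_act M)) (fst (\<omega> m)) \<omega>) \<in> measurable ?X (count_space UNIV)"
    proof (rule measurable_compose_countable[where f="\<lambda>s \<omega>. succ_pmf (ma_P M) s (case snd (\<omega> m) of Inl \<alpha> \<Rightarrow> \<alpha> | Inr t \<Rightarrow> bot_act M)" and g="\<lambda>\<omega>. fst (\<omega> m)"])
      show "(\<lambda>\<omega>. fst (\<omega> m)) \<in> measurable ?X (count_space UNIV)" by measurable
      fix s
      have "(\<lambda>\<omega>. case snd (\<omega> m) of Inl \<alpha> \<Rightarrow> \<alpha> | Inr t \<Rightarrow> bot_act M) \<in> measurable ?X (count_space UNIV)"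
        by (rule measurable_compose[OF _ lab]) measurable
      then show "(\<lambda>\<omega>. succ_pmf (ma_P M) s (case snd (\<omega> m) of Inl \<alpha> \<Rightarrow> \<alpha> | Inr t \<Rightarrow> bot_act M)) \<in> measurable ?X (count_space UNIV)"
        by (rule measurable_compose) simp
    qed
    then show ?thesis using Suc by (simp add: ma_next_def[abs_def])
  qed
  have next': "(\<lambda>\<omega>. measure_pmf (ma_next M i \<omega>)) \<in> measurable ?X (subprob_algebra (count_space UNIV))"
    by (rule measurable_compose[OF nxt])
      (auto simp: space_subprob_algebra intro!: measure_pmf.prob_space_axioms prob_space_imp_subprob_space)
  have Pair: "Pair s \<in> measurable label_space ma_step_space" for s :: 'a
    unfolding ma_step_space_def by simp
  have d: "(\<lambda>\<omega>. distr (ma_label M \<sigma> (map \<omega> [0..<i], s)) ma_step_space (Pair s)) \<in> measurable ?X (subprob_algebra ma_step_space)" for s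
    by (rule measurable_compose[OF ma_label_meas[OF assms] measurable_distr[OF Pair]])
  show "ma_kernel M \<sigma> i \<in> measurable ?X (subprob_algebra ma_step_space)"
    unfolding ma_kernel_def[abs_def]
  proof (rule measurable_bind[OF next'])
    have "(\<lambda>x. (\<lambda>s \<omega>. distr (ma_label M \<sigma> (map \<omega> [0..<i], s)) ma_step_space (Pair s)) (snd x) (fst x)) \<in> measurable (?X \<Otimes>\<^sub>M count_space UNIV) (subprob_algebra ma_step_space)"
      by (rule measurable_compose_countable[where f="\<lambda>s x. distr (ma_label M \<sigma> (map (fst x) [0..<i], s)) ma_step_space (Pair s)" and g=snd, OF measurable_compose[OF measurable_fst d] measurable_snd])
    then show "(\<lambda>x. distr (ma_label M \<sigma> (map (fst x) [0..<i], snd x)) ma_step_space (Pair (snd x))) \<in> measurable (?X \<Otimes>\<^sub>M count_space UNIV) (subprob_algebra ma_step_space)"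
      by simp
  qed
  fix x assume x: "x \<in> space ?X"
  have "(\<lambda>s. distr (ma_label M \<sigma> (map x [0..<i], s)) ma_step_space (Pair s)) \<in> measurable (count_space UNIV) (subprob_algebra ma_step_space)"
    using measurable_space[OF d x] by simp
  moreover have "prob_space (distr (ma_label M \<sigma> (map x [0..<i], s)) ma_step_space (Pair s))" for s
    by (rule prob_space.prob_space_distr[OF ma_label_prob[OF assms(1)]])
      (simp add: Pair measurable_cong_sets[OF sets_ma_label refl])
  ultimately show "prob_space (ma_kernel M \<sigma> i x)"
    unfolding ma_kernel_def
    by (intro prob_space.prob_space_bind[OF measure_pmf.prob_space_axioms]) (auto simp: measurable_pmf_measure1)
qed

end

theory Submission
  imports Defs
begin

text \<open>
  Forgetting the sojourn times maps the paths of the Markov automaton to those of the underlying MDP.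
  Reachability probabilities are determined by the probabilities of the untimed prefixes, so it
  suffices that each scheduler of one model has a counterpart in the other one that gives the same
  probability to every untimed prefix. An MDP scheduler is used in the automaton by ignoring the
  sojourn times. Conversely, a generic scheduler is replaced by its conditional expectation given
  the untimed history, which only changes the choices within a set of timed histories that share
  their untimed prefix.
\<close>

section \<open>Prefixes of trajectories\<close>

text \<open>Averaging is harmless because, given the untimed prefix \<open>h\<close>, the law of the
  next state is read off the last pair of \<open>h\<close> and so does not depend on the sojourn
  times. The probability of extending \<open>h\<close> by \<open>(s, a)\<close> thus splits into a
  next-state factor, the same in both models, and the integral of the choice of \<open>a\<close>
  over the timed histories above \<open>h\<close>. Dividing that integral by the probability of
  \<open>h\<close> gives the choice that the MDP needs. The obstacle is support. Schedulers are
  constrained on paths only, whereas the measures live on all sequences. Labels of the wrong kind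
  and negative sojourn times must first be shown to be null, and histories of positive probability
  must be shown to be paths, before a scheduler may be assumed to choose enabled actions. At a
  Markov state the automaton does not consult its scheduler. This agrees with the MDP, whose only
  enabled action there is the distinguished one. The counterpart scheduler does not depend on the
  goal set, so one scheduler serves all objectives at once, with equal probabilities.\<close>

lemma (in Ionescu_Tulcea) distr_lim_prefix:
  "distr PF.lim (PiM {0..<n} M) (\<lambda>\<omega>. restrict \<omega> {0..<n}) = C 0 n (\<lambda>_. undefined)"
proof (rule measure_eqI)
  fix A assume "A \<in> sets (distr PF.lim (PiM {0..<n} M) (\<lambda>\<omega>. restrict \<omega> {0..<n}))"
  then have A: "A \<in> sets (PiM {0..<n} M)" by simp
  have "prod_emb {0..<n} M {0..<n} A = A"
    using sets.sets_into_space[OF A] by (intro prod_emb_id) (simp add: space_PiM)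
  then show "emeasure (distr PF.lim (PiM {0..<n} M) (\<lambda>\<omega>. restrict \<omega> {0..<n})) A = emeasure (C 0 n (\<lambda>_. undefined)) A"
    using emeasure_CI[OF order_refl A] by (simp add: distr_lim)
qed (simp add: sets_C)

text \<open>The marginal on \<open>n + 1\<close> coordinates is the marginal on \<open>n\<close>
  coordinates bound to \<open>eP n\<close>, which appends one coordinate drawn from
  \<open>P n\<close>. The event therefore integrates to the mass of \<open>B\<close> on histories in
  \<open>A\<close>, and to zero elsewhere.\<close>

lemma (in Ionescu_Tulcea) emeasure_lim_step:
  assumes A[measurable]: "A \<in> sets (PiM {0..<n} M)" and B[measurable]: "B \<in> sets (M n)"
  shows "emeasure PF.lim {\<omega> \<in> space PF.lim. restrict \<omega> {0..<n} \<in> A \<and> \<omega> n \<in> B} =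
    (\<integral>\<^sup>+\<omega>. indicator A (restrict \<omega> {0..<n}) * emeasure (P n (restrict \<omega> {0..<n})) B \<partial>PF.lim)"
proof -
  define A' where "A' = {\<omega> \<in> space (PiM {0..<Suc n} M). restrict \<omega> {0..<n} \<in> A \<and> \<omega> n \<in> B}"
  have r[measurable]: "(\<lambda>\<omega>. restrict \<omega> {0..<m}) \<in> measurable (PiM I M) (PiM {0..<m} M)" if "{0..<m} \<subseteq> I" for I m
    using that by (intro measurable_restrict_subset)
  have c[measurable]: "(\<lambda>\<omega>. \<omega> n) \<in> measurable (PiM {0..<Suc n} M) (M n)"
    by (rule measurable_component_singleton) simp
  have A'[measurable]: "A' \<in> sets (PiM {0..<Suc n} M)"
    unfolding A'_def using r[of n "{0..<Suc n}"] by measurable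
  \<comment> \<open>The product over no coordinates has a single point, from which every trajectory
    starts.\<close>
  have und: "(\<lambda>_. undefined) \<in> space (PiM {0..<0} M)" by (simp add: space_PiM)
  have Psets: "(\<lambda>\<omega>. emeasure (P n \<omega>) B) \<in> borel_measurable (PiM {0..<n} M)"
    by (rule measurable_emeasure_kernel[OF P B])
  have rl: "(\<lambda>\<omega>. restrict \<omega> {0..<m}) \<in> measurable PF.lim (PiM {0..<m} M)" for m
    by (simp add: measurable_cong_sets[OF PF.sets_lim refl] r)
  have "emeasure PF.lim {\<omega> \<in> space PF.lim. restrict \<omega> {0..<n} \<in> A \<and> \<omega> n \<in> B} =
      emeasure (distr PF.lim (PiM {0..<Suc n} M) (\<lambda>\<omega>. restrict \<omega> {0..<Suc n})) A'"
    by (subst emeasure_distr[OF rl A'])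
      (intro arg_cong2[where f=emeasure] refl, auto simp: A'_def space_PiM Int_absorb1)
  also have "\<dots> = emeasure (C 0 n (\<lambda>_. undefined) \<bind> eP n) A'"
    unfolding distr_lim_prefix by simp
  also have "\<dots> = (\<integral>\<^sup>+\<omega>. emeasure (eP n \<omega>) A' \<partial>C 0 n (\<lambda>_. undefined))"
    by (rule emeasure_bind[where N="PiM {0..<Suc n} M"])
      (auto simp: space_C[OF und] measurable_cong_sets[OF sets_C[OF und] refl] space_PiM_empty_iff)
  also have "\<dots> = (\<integral>\<^sup>+\<omega>. indicator A \<omega> * emeasure (P n \<omega>) B \<partial>C 0 n (\<lambda>_. undefined))"
  proof (rule nn_integral_cong)
    fix \<omega> assume "\<omega> \<in> space (C 0 n (\<lambda>_. undefined))"
    then have w: "\<omega> \<in> space (PiM {0..<n} M)" by (simp add: space_C[OF und])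
    \<comment> \<open>Points of the finite product are \<open>undefined\<close> from
      \<open>n\<close> on, so appending a coordinate and restricting again gives back
      \<open>\<omega>\<close> itself.\<close>
    have "restrict (fun_upd \<omega> n x) {0..<n} = \<omega>" for x
      using w by (auto simp: space_PiM PiE_iff extensional_def)
    moreover have "fun_upd \<omega> n x \<in> space (PiM {0..<Suc n} M)" if "x \<in> space (M n)" for x
      using w that by (auto simp: space_PiM PiE_iff extensional_def less_Suc_eq)
    ultimately have "(\<lambda>x. fun_upd \<omega> n x) -` A' \<inter> space (M n) = (if \<omega> \<in> A then B else {})"
      using sets.sets_into_space[OF B] by (auto simp: A'_def)
    then show "emeasure (eP n \<omega>) A' = indicator A \<omega> * emeasure (P n \<omega>) B"
      unfolding emeasure_eP[OF w A'] by simp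
  qed
  also have "\<dots> = (\<integral>\<^sup>+\<omega>. indicator A \<omega> * emeasure (P n \<omega>) B \<partial>distr PF.lim (PiM {0..<n} M) (\<lambda>\<omega>. restrict \<omega> {0..<n}))"
    unfolding distr_lim_prefix ..
  also have "\<dots> = (\<integral>\<^sup>+\<omega>. indicator A (restrict \<omega> {0..<n}) * emeasure (P n (restrict \<omega> {0..<n})) B \<partial>PF.lim)"
    using Psets by (intro nn_integral_distr rl) measurable
  finally show ?thesis .
qed

text \<open>The total mass is already visible in the marginal on no coordinates, which is a point
  mass.\<close>

lemma (in Ionescu_Tulcea) prob_space_lim: "prob_space PF.lim"
proof (rule prob_spaceI)
  have rl: "(\<lambda>\<omega>. restrict \<omega> {0..<0}) \<in> measurable PF.lim (PiM {0..<0} M)"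
    unfolding measurable_cong_sets[OF PF.sets_lim refl] by (rule measurable_restrict_subset) simp
  have "emeasure (distr PF.lim (PiM {0..<0} M) (\<lambda>\<omega>. restrict \<omega> {0..<0})) (space (PiM {0..<0} M)) = 1"
    unfolding distr_lim_prefix by simp
  moreover have "(\<lambda>\<omega>. restrict \<omega> {0..<0}) -` space (PiM {0..<0} M) \<inter> space PF.lim = space PF.lim"
    by (auto simp: space_PiM)
  ultimately show "emeasure PF.lim (space PF.lim) = 1"
    by (subst (asm) emeasure_distr[OF rl sets.top]) (simp only:)
qed

text \<open>The index set \<open>I\<close> is left open because the event is needed both in the
  finite products, where kernels and schedulers are measurable, and in the space of infinite
  paths.\<close>

lemma map_prefix_measurable:
  assumes f: "f \<in> measurable X (count_space UNIV)" and I: "{0..<n} \<subseteq> I"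
  shows "{\<omega> \<in> space (PiM I (\<lambda>_. X)). map (\<lambda>i. f (\<omega> i)) [0..<n] = h} \<in> sets (PiM I (\<lambda>_. X))"
proof (cases "length h = n")
  case True
  have "{\<omega> \<in> space (PiM I (\<lambda>_. X)). \<forall>i\<in>{0..<n}. f (\<omega> i) = h ! i} \<in> sets (PiM I (\<lambda>_. X))"
  proof (rule sets.sets_Collect_finite_All)
    fix i assume "i \<in> {0..<n}"
    then have "(\<lambda>\<omega>. f (\<omega> i)) \<in> measurable (PiM I (\<lambda>_. X)) (count_space UNIV)"
      using I by (intro measurable_compose[OF _ f] measurable_component_singleton) auto
    then have "(\<lambda>\<omega>. f (\<omega> i)) -` {h ! i} \<inter> space (PiM I (\<lambda>_. X)) \<in> sets (PiM I (\<lambda>_. X))"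
      by (rule measurable_sets) simp
    then show "{\<omega> \<in> space (PiM I (\<lambda>_. X)). f (\<omega> i) = h ! i} \<in> sets (PiM I (\<lambda>_. X))"
      by (simp add: vimage_def Int_def conj_commute)
  qed simp
  moreover have "map (\<lambda>i. f (\<omega> i)) [0..<n] = h \<longleftrightarrow> (\<forall>i\<in>{0..<n}. f (\<omega> i) = h ! i)" for \<omega>
    unfolding list_eq_iff_nth_eq using True by (simp add: Ball_def)
  ultimately show ?thesis by (simp only:)
next
  case False
  then have "{\<omega> \<in> space (PiM I (\<lambda>_. X)). map (\<lambda>i. f (\<omega> i)) [0..<n] = h} = {}" by auto
  then show ?thesis by (simp only: sets.empty_sets)
qed

text \<open>The observation \<open>f\<close> lets both models be compared on lists of one type: it
  is \<open>untime M\<close> for the automaton and the identity for the MDP.\<close>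

definition prefix_prob :: "(nat \<Rightarrow> 'x) measure \<Rightarrow> ('x \<Rightarrow> 'y) \<Rightarrow> 'y list \<Rightarrow> ennreal" where
  "prefix_prob \<mu> f h = emeasure \<mu> {\<omega> \<in> space \<mu>. map (\<lambda>i. f (\<omega> i)) [0..<length h] = h}"

text \<open>The kernels take a whole sequence but read only its first \<open>n\<close> entries. The
  Ionescu-Tulcea formulas feed them restricted sequences, and \<open>K_prefix\<close> allows the
  restriction to be dropped.\<close>

locale trajectory = Ionescu_Tulcea K "\<lambda>_. X" for X :: "'x measure" and K +
  assumes K_prefix: "\<And>n \<omega> \<omega>'. map \<omega> [0..<n] = map \<omega>' [0..<n] \<Longrightarrow> K n \<omega> = K n \<omega>'"
begin

abbreviation "T \<equiv> trajectory_measure X K"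

lemma sets_T[measurable_cong]: "sets T = sets (PiM UNIV (\<lambda>_. X))"
  unfolding trajectory_measure_def by simp

lemma space_T: "space T = space (PiM UNIV (\<lambda>_. X))"
  unfolding trajectory_measure_def by simp

end

sublocale trajectory \<subseteq> T: prob_space T
  unfolding trajectory_measure_def by (rule prob_space_lim)

lemma (in trajectory) K_restrict: "K n (restrict \<omega> {0..<n}) = K n \<omega>"
  by (rule K_prefix) simp

lemma (in trajectory) emeasure_T_step:
  assumes A: "A \<in> sets (PiM {0..<n} (\<lambda>_. X))" and B: "B \<in> sets X"
  shows "emeasure T {\<omega> \<in> space T. restrict \<omega> {0..<n} \<in> A \<and> \<omega> n \<in> B} =
    (\<integral>\<^sup>+\<omega>. indicator A (restrict \<omega> {0..<n}) * emeasure (K n \<omega>) B \<partial>T)"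
  unfolding trajectory_measure_def using emeasure_lim_step[OF A B] by (simp only: K_restrict)

text \<open>The kernel stays under the integral because it may depend on parts of the history that
  \<open>f\<close> hides, such as sojourn times.\<close>

lemma (in trajectory) prefix_prob_step:
  assumes f: "f \<in> measurable X (count_space UNIV)"
  shows "prefix_prob T f (h @ [x]) =
    (\<integral>\<^sup>+\<omega>. indicator {\<omega>. map (\<lambda>i. f (\<omega> i)) [0..<length h] = h} \<omega> *
        emeasure (K (length h) \<omega>) (f -` {x} \<inter> space X) \<partial>T)"
proof -
  let ?n = "length h"
  let ?A = "{\<omega> \<in> space (PiM {0..<?n} (\<lambda>_. X)). map (\<lambda>i. f (\<omega> i)) [0..<?n] = h}"
  let ?B = "f -` {x} \<inter> space X"
  have B: "?B \<in> sets X" using f by (rule measurable_sets) simp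
  have r: "restrict \<omega> {0..<?n} \<in> ?A \<longleftrightarrow> map (\<lambda>i. f (\<omega> i)) [0..<?n] = h" if "\<omega> \<in> space T" for \<omega>
  proof -
    have "map (\<lambda>i. f (restrict \<omega> {0..<?n} i)) [0..<?n] = map (\<lambda>i. f (\<omega> i)) [0..<?n]"
      by (rule map_cong) auto
    moreover have "restrict \<omega> {0..<?n} \<in> space (PiM {0..<?n} (\<lambda>_. X))"
      using that by (simp add: space_T space_PiM PiE_iff)
    ultimately show ?thesis by (simp only: mem_Collect_eq simp_thms)
  qed
  have "prefix_prob T f (h @ [x]) = emeasure T {\<omega> \<in> space T. restrict \<omega> {0..<?n} \<in> ?A \<and> \<omega> ?n \<in> ?B}"
    unfolding prefix_prob_def
  proof (intro arg_cong[where f="emeasure T"] Collect_cong conj_cong refl)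
    fix \<omega> assume w: "\<omega> \<in> space T"
    then have "\<omega> ?n \<in> space X" by (simp add: space_T space_PiM PiE_iff)
    then show "map (\<lambda>i. f (\<omega> i)) [0..<length (h @ [x])] = h @ [x] \<longleftrightarrow>
        restrict \<omega> {0..<?n} \<in> ?A \<and> \<omega> ?n \<in> ?B"
      unfolding r[OF w] by simp
  qed
  also have "\<dots> = (\<integral>\<^sup>+\<omega>. indicator ?A (restrict \<omega> {0..<?n}) * emeasure (K ?n \<omega>) ?B \<partial>T)"
    by (rule emeasure_T_step[OF map_prefix_measurable[OF f order_refl] B])
  also have "\<dots> = (\<integral>\<^sup>+\<omega>. indicator {\<omega>. map (\<lambda>i. f (\<omega> i)) [0..<length h] = h} \<omega> *
        emeasure (K (length h) \<omega>) ?B \<partial>T)"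
  proof (intro nn_integral_cong arg_cong2[where f="(*)"] refl)
    fix \<omega> assume "\<omega> \<in> space T"
    from r[OF this] show "(indicator ?A (restrict \<omega> {0..<?n}) :: ennreal) =
        indicator {\<omega>. map (\<lambda>i. f (\<omega> i)) [0..<length h] = h} \<omega>"
      unfolding indicator_def by (simp only: mem_Collect_eq)
  qed
  finally show ?thesis .
qed

lemma (in trajectory) prefix_prob_Nil: "prefix_prob T f [] = 1"
  by (simp add: prefix_prob_def T.emeasure_space_1)

lemma (in trajectory) prefix_set_measurable:
  assumes f: "f \<in> measurable X (count_space UNIV)"
  shows "{\<omega> \<in> space T. map (\<lambda>i. f (\<omega> i)) [0..<n] = h} \<in> sets T"
  unfolding sets_T space_T by (rule map_prefix_measurable[OF f]) simp

lemma (in trajectory) AE_T_coordinate: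
  assumes B: "B \<in> sets X" and K: "\<And>\<omega>. emeasure (K n \<omega>) B = 0"
  shows "AE \<omega> in T. \<omega> n \<notin> B"
proof (rule AE_I)
  have "emeasure T {\<omega> \<in> space T. restrict \<omega> {0..<n} \<in> space (PiM {0..<n} (\<lambda>_. X)) \<and> \<omega> n \<in> B} = 0"
    by (subst emeasure_T_step[OF sets.top B]) (simp add: K)
  moreover have "{\<omega> \<in> space T. restrict \<omega> {0..<n} \<in> space (PiM {0..<n} (\<lambda>_. X)) \<and> \<omega> n \<in> B} = {\<omega> \<in> space T. \<omega> n \<in> B}"
    by (auto simp: space_T space_PiM)
  ultimately show "emeasure T {\<omega> \<in> space T. \<omega> n \<in> B} = 0" by simp
  have "(\<lambda>\<omega>. \<omega> n) \<in> measurable T X"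
    unfolding measurable_cong_sets[OF sets_T refl] by simp
  then have "(\<lambda>\<omega>. \<omega> n) -` B \<inter> space T \<in> sets T" using B by (rule measurable_sets)
  then show "{\<omega> \<in> space T. \<omega> n \<in> B} \<in> sets T" by (simp add: vimage_def Int_def conj_commute)
qed auto

text \<open>Reaching \<open>B\<close> is the increasing union of reaching it within \<open>n\<close>
  steps. Since \<open>f\<close> takes finitely many values, each of these events is a finite
  disjoint union of prefix events, so prefix probabilities determine the limit.\<close>

lemma (in trajectory) reach_prob_lim:
  fixes f :: "'x \<Rightarrow> 'y::finite"
  assumes f: "f \<in> measurable X (count_space UNIV)"
  shows "(\<lambda>n. \<Sum>h\<in>{h. length h = n \<and> (\<exists>y\<in>set h. y \<in> B)}. prefix_prob T f h) \<longlonglongrightarrow>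
    emeasure T {\<omega> \<in> space T. \<exists>i. f (\<omega> i) \<in> B}"
proof -
  let ?H = "\<lambda>n. {h :: 'y list. length h = n \<and> (\<exists>y\<in>set h. y \<in> B)}"
  let ?S = "\<lambda>n h. {\<omega> \<in> space T. map (\<lambda>i. f (\<omega> i)) [0..<n] = h}"
  have fin: "finite (?H n)" for n
    by (rule finite_subset[OF _ finite_lists_length_eq[of UNIV n]]) auto
  define E where "E n = {\<omega> \<in> space T. map (\<lambda>i. f (\<omega> i)) [0..<n] \<in> ?H n}" for n
  have "{\<omega> \<in> A. g \<omega> \<in> H} = (\<Union>h\<in>H. {\<omega> \<in> A. g \<omega> = h})"
    for A :: "(nat \<Rightarrow> 'x) set" and g :: "_ \<Rightarrow> 'y list" and H
    by blast
  then have E_un: "E n = (\<Union>h\<in>?H n. ?S n h)" for n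
    unfolding E_def by this
  have sets_E: "E n \<in> sets T" for n
    unfolding E_un using fin by (intro sets.finite_UN prefix_set_measurable[OF f]) auto
  have E: "emeasure T (E n) = (\<Sum>h\<in>?H n. prefix_prob T f h)" for n
  proof -
    have "emeasure T (E n) = (\<Sum>h\<in>?H n. emeasure T (?S n h))"
      unfolding E_un using fin
      by (intro sum_emeasure[symmetric]) (auto simp: disjoint_family_on_def prefix_set_measurable[OF f])
    also have "\<dots> = (\<Sum>h\<in>?H n. prefix_prob T f h)"
      by (intro sum.cong refl) (auto simp: prefix_prob_def)
    finally show ?thesis .
  qed
  have E_iff: "\<omega> \<in> E n \<longleftrightarrow> \<omega> \<in> space T \<and> (\<exists>i<n. f (\<omega> i) \<in> B)" for \<omega> n
    by (auto simp: E_def)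
  have "incseq E"
    by (intro incseq_SucI) (auto simp: E_iff less_Suc_eq)
  then have "(\<lambda>n. emeasure T (E n)) \<longlonglongrightarrow> emeasure T (\<Union>n. E n)"
    using sets_E by (intro Lim_emeasure_incseq) auto
  also have "(\<Union>n. E n) = {\<omega> \<in> space T. \<exists>i. f (\<omega> i) \<in> B}"
    by (auto simp: E_iff) (blast intro: lessI)
  finally show ?thesis unfolding E .
qed

lemma reach_prob_eq:
  fixes f :: "'x \<Rightarrow> 'y::finite"
  assumes "trajectory X K" "f \<in> measurable X (count_space UNIV)"
    and "trajectory X' K'" "f' \<in> measurable X' (count_space UNIV)"
    and eq: "\<And>h. prefix_prob (trajectory_measure X K) f h = prefix_prob (trajectory_measure X' K') f' h"
  shows "emeasure (trajectory_measure X K) {\<omega> \<in> space (trajectory_measure X K). \<exists>i. f (\<omega> i) \<in> B} =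
    emeasure (trajectory_measure X' K') {\<omega> \<in> space (trajectory_measure X' K'). \<exists>i. f' (\<omega> i) \<in> B}"
  using trajectory.reach_prob_lim[OF assms(1,2), of B] trajectory.reach_prob_lim[OF assms(3,4), of B]
  unfolding eq by (rule LIMSEQ_unique)

section \<open>Paths of the MDP\<close>

fun untime :: "('s, 'a) ma \<Rightarrow> 's \<times> ('a + real) \<Rightarrow> 's \<times> 'a" where
  "untime M (s, Inl \<alpha>) = (s, \<alpha>)"
| "untime M (s, Inr t) = (s, bot_act M)"

lemma untime_conv: "untime M x = (fst x, case snd x of Inl \<alpha> \<Rightarrow> \<alpha> | Inr t \<Rightarrow> bot_act M)"
  by (cases "(M, x)" rule: untime.cases) simp_all

text \<open>This is the factor shared by the two models: \<open>mdp_next\<close> and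
  \<open>ma_next\<close> both coincide with it once the untimed prefix is known to be
  \<open>h\<close>.\<close>

definition next_state :: "('s::finite, 'a::finite) mdp \<Rightarrow> ('s \<times> 'a) list \<Rightarrow> 's pmf" where
  "next_state D h = (if h = [] then return_pmf (mdp_init D)
     else succ_pmf (mdp_P D) (fst (last h)) (snd (last h)))"

lemma underlying_mdp_simps[simp]:
  "mdp_P (underlying_mdp M) = ma_P M" "mdp_init (underlying_mdp M) = ma_init M"
  by (simp_all add: underlying_mdp_def)

lemma mdp_next_eq_next_state: "map \<omega> [0..<length h] = h \<Longrightarrow> mdp_next D (length h) \<omega> = next_state D h"
  by (cases h rule: rev_cases) (auto simp: mdp_next_def next_state_def)

lemma mdp_next_prefix: "map \<omega> [0..<n] = map \<omega>' [0..<n] \<Longrightarrow> mdp_next D n \<omega> = mdp_next D n \<omega>'"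
  by (cases n) (auto simp: mdp_next_def)

interpretation mdp: trajectory "count_space UNIV" "mdp_kernel D \<sigma>"
  for D :: "('s::finite, 'a::finite) mdp" and \<sigma>
proof (rule trajectory.intro[OF mdp_Ionescu_Tulcea trajectory_axioms.intro])
  show "mdp_kernel D \<sigma> n \<omega> = mdp_kernel D \<sigma> n \<omega>'" if "map \<omega> [0..<n] = map \<omega>' [0..<n]" for n \<omega> \<omega>'
    unfolding mdp_kernel_def mdp_next_prefix[OF that] that ..
qed

lemma emeasure_mdp_kernel:
  "emeasure (mdp_kernel D \<sigma> n \<omega>) {(s, a)} =
    ennreal (pmf (mdp_next D n \<omega>) s) * ennreal (pmf (\<sigma> (map \<omega> [0..<n], s)) a)"
proof -
  have *: "pmf (map_pmf (Pair s') p) (s, a) = indicator {s} s' * pmf p a" for s' and p :: "'b pmf"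
  proof (cases "s' = s")
    case True
    moreover have "inj (Pair s')" by (rule injI) simp
    ultimately show ?thesis using pmf_map_inj'[of "Pair s'" p a] by simp
  next
    case False
    then show ?thesis by (auto simp: pmf_eq_0_set_pmf)
  qed
  have "emeasure (mdp_kernel D \<sigma> n \<omega>) {(s, a)} =
      (\<integral>\<^sup>+s'. ennreal (indicator {s} s' * pmf (\<sigma> (map \<omega> [0..<n], s')) a) \<partial>mdp_next D n \<omega>)"
    by (simp add: mdp_kernel_def emeasure_pmf_single ennreal_pmf_bind *)
  also have "\<dots> = (\<integral>\<^sup>+s'. ennreal (pmf (\<sigma> (map \<omega> [0..<n], s)) a) * indicator {s} s' \<partial>mdp_next D n \<omega>)"
    by (intro nn_integral_cong) (auto split: split_indicator)
  also have "\<dots> = ennreal (pmf (\<sigma> (map \<omega> [0..<n], s)) a) * emeasure (measure_pmf (mdp_next D n \<omega>)) {s}"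
    by (rule nn_integral_cmult_indicator) simp
  finally show ?thesis by (simp add: emeasure_pmf_single mult.commute)
qed

text \<open>Nothing is hidden by the identity observation, so the integrand of
  \<open>prefix_prob_step\<close> is constant on the prefix event and the integral becomes a
  product.\<close>

lemma mdp_prefix_prob_snoc:
  "prefix_prob (mdp_measure D \<sigma>) (\<lambda>x. x) (h @ [(s, a)]) =
    prefix_prob (mdp_measure D \<sigma>) (\<lambda>x. x) h * ennreal (pmf (next_state D h) s) * ennreal (pmf (\<sigma> (h, s)) a)"
proof -
  let ?T = "mdp_measure D \<sigma>"
  let ?c = "ennreal (pmf (next_state D h) s) * ennreal (pmf (\<sigma> (h, s)) a)"
  let ?S = "{\<omega>. map \<omega> [0..<length h] = h}"
  have S: "{\<omega> \<in> space ?T. map (\<lambda>i. \<omega> i) [0..<length h] = h} = ?S"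
    by (simp add: mdp_measure_def mdp.space_T space_PiM)
  have "prefix_prob ?T (\<lambda>x. x) (h @ [(s, a)]) =
      (\<integral>\<^sup>+\<omega>. indicator ?S \<omega> * emeasure (mdp_kernel D \<sigma> (length h) \<omega>) {(s, a)} \<partial>?T)"
    using mdp.prefix_prob_step[of "\<lambda>x. x" D \<sigma> h "(s, a)"] by (simp add: mdp_measure_def vimage_def)
  also have "\<dots> = (\<integral>\<^sup>+\<omega>. ?c * indicator ?S \<omega> \<partial>?T)"
    by (intro nn_integral_cong) (auto simp: emeasure_mdp_kernel mdp_next_eq_next_state split: split_indicator)
  also have "\<dots> = ?c * prefix_prob ?T (\<lambda>x. x) h"
    using mdp.prefix_set_measurable[of "\<lambda>x. x" D \<sigma> "length h" h]
    by (subst nn_integral_cmult_indicator) (auto simp: mdp_measure_def[symmetric] prefix_prob_def S)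
  finally show ?thesis by (simp add: ac_simps)
qed

lemma mdp_prefix_prob_Nil: "prefix_prob (mdp_measure D \<sigma>) f [] = 1"
  unfolding mdp_measure_def by (rule mdp.prefix_prob_Nil)

lemma pmf_succ_pmf:
  assumes "is_mdp D" "\<alpha> \<in> mdp_enabled D s"
  shows "pmf (succ_pmf (mdp_P D) s \<alpha>) s' = mdp_P D s \<alpha> s'"
proof -
  have nonneg: "0 \<le> mdp_P D s \<alpha> x" for x using assms(1) by (auto simp: is_mdp_def)
  have sum: "(\<Sum>x\<in>UNIV. mdp_P D s \<alpha> x) = 1" using assms(2) by (simp add: mdp_enabled_def)
  have "(\<integral>\<^sup>+x. ennreal (mdp_P D s \<alpha> x) \<partial>count_space UNIV) = 1"
    using sum by (simp add: nn_integral_count_space_finite sum_ennreal nonneg)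
  then show ?thesis using sum nonneg by (simp add: succ_pmf_def pmf_embed_pmf)
qed

text \<open>This makes the scheduler condition, which speaks of paths only, usable for every history
  of positive probability. The induction needs that condition itself: an enabled action is what
  rules out the default branch of \<open>succ_pmf\<close>.\<close>

lemma mdp_fpath_of_prefix_prob:
  assumes D: "is_mdp D" and \<sigma>: "mdp_scheduler D \<sigma>"
  shows "prefix_prob (mdp_measure D \<sigma>) (\<lambda>x. x) h \<noteq> 0 \<Longrightarrow> pmf (next_state D h) s \<noteq> 0 \<Longrightarrow> mdp_fpath D (h, s)"
proof (induction h arbitrary: s rule: rev_induct)
  case Nil
  then show ?case by (auto simp: next_state_def pmf_return intro: mdp_fpath.start split: split_indicator_asm)
next
  case (snoc x h)
  obtain s0 a where x: "x = (s0, a)" by (cases x)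
  from snoc.prems(1) have "prefix_prob (mdp_measure D \<sigma>) (\<lambda>x. x) h \<noteq> 0" "pmf (next_state D h) s0 \<noteq> 0"
    and a: "pmf (\<sigma> (h, s0)) a \<noteq> 0"
    by (auto simp: x mdp_prefix_prob_snoc)
  with snoc.IH have path: "mdp_fpath D (h, s0)" by blast
  then have "a \<in> mdp_enabled D s0"
    using \<sigma> a unfolding mdp_scheduler_def by (force simp: set_pmf_iff)
  then have "mdp_P D s0 a s \<noteq> 0"
    using snoc.prems(2) pmf_succ_pmf[OF D] by (simp add: next_state_def x)
  then have "mdp_P D s0 a s > 0" using D by (auto simp: is_mdp_def less_le)
  with path show ?case unfolding x by (rule mdp_fpath.step)
qed

lemma mdp_fpath_snocD:
  assumes "mdp_fpath D (h @ [(s, \<alpha>)], s')"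
  shows "mdp_fpath D (h, s)" "mdp_P D s \<alpha> s' > 0"
  using assms by (auto elim: mdp_fpath.cases)

section \<open>Paths of the Markov automaton\<close>

lemma label_sets:
  assumes "B \<in> sets borel" shows "Inl ` A \<union> Inr ` B \<in> sets label_space"
  using assms unfolding sets_label_gen by (intro sigma_sets_Un sigma_sets.Basic) auto

lemma untime_measurable: "untime M \<in> measurable ma_step_space (count_space UNIV)"
proof -
  have "(\<lambda>\<kappa>. case \<kappa> of Inl \<alpha> \<Rightarrow> \<alpha> | Inr t \<Rightarrow> bot_act M) \<in> measurable label_space (count_space UNIV)"
  proof (rule measurableI)
    fix A :: "'b set"
    have "(\<lambda>\<kappa>. case \<kappa> of Inl \<alpha> \<Rightarrow> \<alpha> | Inr (t::real) \<Rightarrow> bot_act M) -` A =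
        Inl ` A \<union> Inr ` (if bot_act M \<in> A then UNIV else {})"
      by (auto simp: image_iff split: sum.splits if_splits)
    then show "(\<lambda>\<kappa>. case \<kappa> of Inl \<alpha> \<Rightarrow> \<alpha> | Inr t \<Rightarrow> bot_act M) -` A \<inter> space label_space \<in> sets label_space"
      by (simp add: label_sets del: image_empty)
  qed simp
  then have [measurable]: "(\<lambda>x. case snd x of Inl \<alpha> \<Rightarrow> \<alpha> | Inr t \<Rightarrow> bot_act M) \<in> measurable ma_step_space (count_space UNIV)"
    unfolding ma_step_space_def by (rule measurable_compose[OF measurable_snd])
  have [measurable]: "fst \<in> measurable ma_step_space (count_space UNIV)"
    by (simp add: ma_step_space_def)
  have "untime M \<in> measurable ma_step_space (count_space UNIV \<Otimes>\<^sub>M count_space UNIV)"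
    unfolding untime_conv[abs_def] by measurable
  then show ?thesis by (simp add: pair_measure_countable)
qed

lemma space_ma_step_space[simp]: "space ma_step_space = UNIV"
  by (simp add: ma_step_space_def space_pair_measure)

lemma ma_next_eq_next_state:
  "map (\<lambda>i. untime M (\<omega> i)) [0..<length h] = h \<Longrightarrow> ma_next M (length h) \<omega> = next_state (underlying_mdp M) h"
  by (cases h rule: rev_cases) (auto simp: ma_next_def next_state_def untime_conv)

lemma ma_next_prefix: "map \<omega> [0..<n] = map \<omega>' [0..<n] \<Longrightarrow> ma_next M n \<omega> = ma_next M n \<omega>'"
  by (cases n) (auto simp: ma_next_def)

locale scheduled_ma =
  fixes M :: "('s::finite, 'a::finite) ma" and \<sigma> :: "('s, 'a + real) fpath \<Rightarrow> 'a pmf"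
  assumes wf: "ma_wf M" and \<sigma>: "ma_scheduler M \<sigma>"

sublocale scheduled_ma \<subseteq> trajectory ma_step_space "ma_kernel M \<sigma>"
proof (rule trajectory.intro[OF ma_Ionescu_Tulcea[OF wf \<sigma>] trajectory_axioms.intro])
  show "ma_kernel M \<sigma> n \<omega> = ma_kernel M \<sigma> n \<omega>'" if "map \<omega> [0..<n] = map \<omega>' [0..<n]" for n \<omega> \<omega>'
    unfolding ma_kernel_def ma_next_prefix[OF that] that ..
qed

lemma (in scheduled_ma) emeasure_ma_kernel:
  assumes B: "B \<in> sets ma_step_space"
  shows "emeasure (ma_kernel M \<sigma> n \<omega>) B =
    (\<integral>\<^sup>+s. emeasure (ma_label M \<sigma> (map \<omega> [0..<n], s)) (Pair s -` B) \<partial>ma_next M n \<omega>)"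
proof -
  have Pair: "Pair s \<in> measurable (ma_label M \<sigma> \<pi>) ma_step_space" for s \<pi>
    unfolding measurable_cong_sets[OF sets_ma_label refl] ma_step_space_def
    by (rule measurable_Pair1') simp
  have sp: "space (ma_label M \<sigma> \<pi>) = UNIV" for \<pi>
    using sets_eq_imp_space_eq[OF sets_ma_label] by simp
  have "subprob_space (distr (ma_label M \<sigma> \<pi>) ma_step_space (Pair s))" for s \<pi>
    by (intro prob_space_imp_subprob_space prob_space.prob_space_distr[OF ma_label_prob[OF wf]] Pair)
  then have "(\<lambda>s. distr (ma_label M \<sigma> (map \<omega> [0..<n], s)) ma_step_space (Pair s))
      \<in> measurable (measure_pmf (ma_next M n \<omega>)) (subprob_algebra ma_step_space)"
    by (auto simp: measurable_pmf_measure1 space_subprob_algebra)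
  then show ?thesis
    unfolding ma_kernel_def by (subst emeasure_bind[OF _ _ B]) (auto simp: emeasure_distr[OF Pair B] sp)
qed

text \<open>The probability that the label drawn after \<open>\<pi>\<close> untimes to
  \<open>\<alpha>\<close>. It differs from the choice of \<open>\<sigma>\<close> at Markov states,
  where a sojourn time is drawn instead and every sojourn time untimes to
  \<open>bot_act M\<close>.\<close>

definition label_prob ::
    "('s::finite, 'a::finite) ma \<Rightarrow> (('s, 'a + real) fpath \<Rightarrow> 'a pmf) \<Rightarrow> ('s, 'a + real) fpath \<Rightarrow> 'a \<Rightarrow> real" where
  "label_prob M \<sigma> \<pi> \<alpha> = (if snd \<pi> \<in> markov_states M then indicator {bot_act M} \<alpha> else pmf (\<sigma> \<pi>) \<alpha>)"

lemma label_prob_nonneg: "0 \<le> label_prob M \<sigma> \<pi> \<alpha>"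
  by (simp add: label_prob_def)

lemma sum_label_prob: "(\<Sum>\<alpha>\<in>UNIV. label_prob M \<sigma> \<pi> \<alpha>) = 1"
  by (cases "snd \<pi> \<in> markov_states M") (simp_all add: label_prob_def sum_pmf_eq_1 indicator_def)

lemma (in scheduled_ma) emeasure_ma_kernel_untime:
  "emeasure (ma_kernel M \<sigma> n \<omega>) (untime M -` {(s, a)}) =
    ennreal (pmf (ma_next M n \<omega>) s) * ennreal (label_prob M \<sigma> (map \<omega> [0..<n], s) a)"
proof -
  \<comment> \<open>The labels that untime to \<open>a\<close>: the action itself and, if
    \<open>a\<close> is \<open>bot_act M\<close>, all real numbers.\<close>
  let ?L = "Inl ` {a} \<union> Inr ` (if a = bot_act M then UNIV else {}) :: ('a + real) set"
  have B: "untime M -` {(s, a)} \<in> sets ma_step_space"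
    using measurable_sets[OF untime_measurable, of "{(s, a)}"] by simp
  have L: "?L \<in> sets label_space" by (rule label_sets) simp
  have v: "Pair s' -` (untime M -` {(s, a)}) = (if s' = s then ?L else {})" for s'
    by (auto simp: untime_conv image_iff split: sum.splits if_splits)
  have lab: "emeasure (ma_label M \<sigma> (h, s)) ?L = ennreal (label_prob M \<sigma> (h, s) a)" for h
  proof (cases "s \<in> markov_states M")
    case True
    then have "prob_space (density lborel (exponential_density (exit_rate M s)))"
      by (intro prob_space_exponential_density exit_rate_pos wf)
    note 1 = prob_space.emeasure_space_1[OF this]
    have "Inr -` ?L = (if a = bot_act M then UNIV else {})" by auto
    with True 1 L show ?thesis by (simp add: ma_label_def label_prob_def emeasure_distr)
  next
    case False
    have "Inl -` ?L = {a}" by auto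
    with False L show ?thesis by (simp add: ma_label_def label_prob_def emeasure_distr emeasure_pmf_single)
  qed
  have "emeasure (ma_kernel M \<sigma> n \<omega>) (untime M -` {(s, a)}) =
      (\<integral>\<^sup>+s'. ennreal (label_prob M \<sigma> (map \<omega> [0..<n], s) a) * indicator {s} s' \<partial>ma_next M n \<omega>)"
    unfolding emeasure_ma_kernel[OF B] v
  proof (rule nn_integral_cong)
    fix s'
    show "emeasure (ma_label M \<sigma> (map \<omega> [0..<n], s')) (if s' = s then ?L else {}) =
        ennreal (label_prob M \<sigma> (map \<omega> [0..<n], s) a) * indicator {s} s'"
      using lab[of "map \<omega> [0..<n]"] by (cases "s' = s") simp_all
  qed
  also have "\<dots> = ennreal (label_prob M \<sigma> (map \<omega> [0..<n], s) a) * emeasure (measure_pmf (ma_next M n \<omega>)) {s}"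
    by (rule nn_integral_cmult_indicator) simp
  finally show ?thesis by (simp add: emeasure_pmf_single mult.commute)
qed

text \<open>
  Unlike being a path, this property does not refer to the transition probabilities. It is what a
  path of the automaton requires in addition to its untimed version being a path of the MDP.
\<close>

inductive wf_step :: "('s, 'a) ma \<Rightarrow> 's \<times> ('a + real) \<Rightarrow> bool" for M where
  delay: "s \<in> markov_states M \<Longrightarrow> t \<ge> 0 \<Longrightarrow> wf_step M (s, Inr t)"
| action: "s \<notin> markov_states M \<Longrightarrow> wf_step M (s, Inl \<alpha>)"

lemma (in scheduled_ma) ma_fpath_of_mdp_fpath:
  "mdp_fpath (underlying_mdp M) (map (untime M) h, s) \<Longrightarrow> \<forall>x\<in>set h. wf_step M x \<Longrightarrow> ma_fpath M (h, s)"
proof (induction h arbitrary: s rule: rev_induct)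
  case Nil
  then have "s = ma_init M" by (auto elim: mdp_fpath.cases)
  then show ?case by (simp add: ma_fpath.start)
next
  case (snoc x h)
  obtain s0 \<kappa> where x: "x = (s0, \<kappa>)" by (cases x)
  define a where "a = snd (untime M x)"
  have u: "untime M x = (s0, a)" by (simp add: a_def x untime_conv)
  from snoc.prems(1) have path: "mdp_fpath (underlying_mdp M) (map (untime M) h, s0)" and P: "ma_P M s0 a s > 0"
    using mdp_fpath_snocD[of "underlying_mdp M" "map (untime M) h" s0 a s] by (auto simp: u)
  have IH: "ma_fpath M (h, s0)" using snoc.IH[OF path] snoc.prems(2) by auto
  have w: "wf_step M (s0, \<kappa>)" using snoc.prems(2) x by auto
  show ?case
  proof (cases "s0 \<in> markov_states M")
    case True
    with w obtain t where "\<kappa> = Inr t" "t \<ge> 0" by (auto simp: wf_step.simps)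
    with True IH P show ?thesis by (auto simp: x a_def untime_conv intro: ma_fpath.delay)
  next
    case False
    with w obtain \<alpha> where "\<kappa> = Inl \<alpha>" by (auto simp: wf_step.simps)
    moreover have "s0 \<in> prob_states M" using wf False unfolding ma_wf_def by blast
    ultimately show ?thesis using IH P by (auto simp: x a_def untime_conv intro: ma_fpath.action)
  qed
qed

lemma mdp_fpath_of_ma_fpath:
  "ma_fpath M \<pi> \<Longrightarrow> mdp_fpath (underlying_mdp M) (map (untime M) (fst \<pi>), snd \<pi>)"
proof (induction rule: ma_fpath.induct)
  case start
  then show ?case using mdp_fpath.start[of "underlying_mdp M"] by simp
next
  case (action h s \<alpha> s')
  have "untime M (s, Inl \<alpha>) = (s, \<alpha>)" by (simp add: untime_conv)
  with action show ?case using mdp_fpath.step[of "underlying_mdp M" "map (untime M) h" s \<alpha> s'] by simp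
next
  case (delay h s t s')
  have "untime M (s, Inr t) = (s, bot_act M)" by (simp add: untime_conv)
  with delay show ?case using mdp_fpath.step[of "underlying_mdp M" "map (untime M) h" s "bot_act M" s'] by simp
qed

text \<open>The label measure at \<open>s\<close> gives no mass to the set \<open>L s\<close> of
  ill-formed labels: it draws a real number exactly at Markov states, and the exponential density
  vanishes below zero. Countably many coordinates keep the exceptional set null.\<close>

lemma (in scheduled_ma) AE_wf_step: "AE \<omega> in ma_measure M \<sigma>. \<forall>n. wf_step M (\<omega> n)"
proof -
  let ?B = "{x. \<not> wf_step M x}"
  define L :: "'s \<Rightarrow> ('a + real) set"
    where "L s = (if s \<in> markov_states M then Inl ` UNIV \<union> Inr ` {..<0} else Inl ` {} \<union> Inr ` UNIV)" for s
  have L: "L s \<in> sets label_space" for s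
    unfolding L_def by (auto intro!: label_sets simp del: image_empty Un_empty_left)
  have v: "Pair s -` ?B = L s" for s
  proof (rule set_eqI)
    fix \<kappa> show "\<kappa> \<in> Pair s -` ?B \<longleftrightarrow> \<kappa> \<in> L s" by (cases \<kappa>) (auto simp: L_def wf_step.simps)
  qed
  have "?B = (\<Union>s. {s} \<times> L s)" unfolding v[symmetric] by auto
  also have "\<dots> \<in> sets ma_step_space"
    unfolding ma_step_space_def by (intro sets.finite_UN pair_measureI L) auto
  finally have B: "?B \<in> sets ma_step_space" .
  have lab: "emeasure (ma_label M \<sigma> (h, s)) (L s) = 0" for h s
  proof (cases "s \<in> markov_states M")
    case True
    have "emeasure (density lborel (exponential_density (exit_rate M s))) {..<0} = 0"
      by (subst emeasure_density)
        (auto simp: nn_integral_0_iff_AE exponential_density_def split: split_indicator)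
    moreover have "Inr -` L s = {..<0}" using True by (auto simp: L_def)
    ultimately show ?thesis using True L[of s] by (simp add: ma_label_def emeasure_distr)
  next
    case False
    then have "Inl -` L s = {}" by (auto simp: L_def)
    with False L[of s] show ?thesis by (simp add: ma_label_def emeasure_distr)
  qed
  have "AE \<omega> in T. \<omega> n \<notin> ?B" for n
    by (rule AE_T_coordinate[OF B]) (simp only: emeasure_ma_kernel[OF B] v lab nn_integral_const mult_zero_left)
  then show ?thesis unfolding ma_measure_def by (simp add: AE_all_countable)
qed

lemma (in scheduled_ma) label_prob_measurable:
  "(\<lambda>\<omega>. ennreal (label_prob M \<sigma> (map \<omega> [0..<n], s) a)) \<in> borel_measurable (ma_measure M \<sigma>)"
proof -
  have "(\<lambda>\<omega>. pmf (\<sigma> (map \<omega> [0..<n], s)) a) \<in> borel_measurable (PiM {0..<n} (\<lambda>_. ma_step_space))"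
    using \<sigma> unfolding ma_scheduler_def by blast
  moreover have "(\<lambda>\<omega>. restrict \<omega> {0..<n}) \<in> measurable T (PiM {0..<n} (\<lambda>_. ma_step_space))"
    unfolding measurable_cong_sets[OF sets_T refl] by (rule measurable_restrict_subset) simp
  ultimately have "(\<lambda>\<omega>. pmf (\<sigma> (map (restrict \<omega> {0..<n}) [0..<n], s)) a) \<in> borel_measurable T"
    by (rule measurable_compose[rotated])
  moreover have "map (restrict \<omega> {0..<n}) [0..<n] = map \<omega> [0..<n]" for \<omega> :: "nat \<Rightarrow> 's \<times> ('a + real)"
    by simp
  ultimately have "(\<lambda>\<omega>. pmf (\<sigma> (map \<omega> [0..<n], s)) a) \<in> borel_measurable T"
    by (simp only:)
  then show ?thesis by (simp add: label_prob_def ma_measure_def)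
qed

section \<open>Joint law of the untimed prefix and the next choice\<close>

text \<open>
  The probability that the untimed prefix is \<open>h\<close> and that the scheduler would choose \<open>a\<close> if the next
  state were \<open>s\<close>. The transition probability into \<open>s\<close> is left out because it depends on \<open>h\<close> only.
\<close>

definition joint_prob ::
    "('s::finite, 'a::finite) ma \<Rightarrow> (('s, 'a + real) fpath \<Rightarrow> 'a pmf) \<Rightarrow> ('s \<times> 'a) list \<Rightarrow> 's \<Rightarrow> 'a \<Rightarrow> ennreal" where
  "joint_prob M \<sigma> h s a = (\<integral>\<^sup>+\<omega>. indicator {\<omega>. map (\<lambda>i. untime M (\<omega> i)) [0..<length h] = h} \<omega> *
     ennreal (label_prob M \<sigma> (map \<omega> [0..<length h], s) a) \<partial>ma_measure M \<sigma>)"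

lemma (in scheduled_ma) ma_prefix_set:
  "{\<omega> \<in> space (ma_measure M \<sigma>). map (\<lambda>i. untime M (\<omega> i)) [0..<n] = h} = {\<omega>. map (\<lambda>i. untime M (\<omega> i)) [0..<n] = h}"
  "{\<omega>. map (\<lambda>i. untime M (\<omega> i)) [0..<n] = h} \<in> sets (ma_measure M \<sigma>)"
proof -
  show *: "{\<omega> \<in> space (ma_measure M \<sigma>). map (\<lambda>i. untime M (\<omega> i)) [0..<n] = h} = {\<omega>. map (\<lambda>i. untime M (\<omega> i)) [0..<n] = h}"
    by (simp add: ma_measure_def space_T space_PiM)
  show "{\<omega>. map (\<lambda>i. untime M (\<omega> i)) [0..<n] = h} \<in> sets (ma_measure M \<sigma>)"
    unfolding *[symmetric] unfolding ma_measure_def by (rule prefix_set_measurable[OF untime_measurable])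
qed

lemma (in scheduled_ma) joint_prob_integrand_measurable:
  "(\<lambda>\<omega>. indicator {\<omega>. map (\<lambda>i. untime M (\<omega> i)) [0..<length h] = h} \<omega> *
     ennreal (label_prob M \<sigma> (map \<omega> [0..<length h], s) a)) \<in> borel_measurable (ma_measure M \<sigma>)"
  by (intro borel_measurable_times_ennreal borel_measurable_indicator ma_prefix_set(2) label_prob_measurable)

lemma (in scheduled_ma) ma_prefix_prob_eq_integral:
  "prefix_prob (ma_measure M \<sigma>) (untime M) h =
    (\<integral>\<^sup>+\<omega>. indicator {\<omega>. map (\<lambda>i. untime M (\<omega> i)) [0..<length h] = h} \<omega> \<partial>ma_measure M \<sigma>)"
  unfolding prefix_prob_def ma_prefix_set(1) by (rule nn_integral_indicator[OF ma_prefix_set(2), symmetric])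

text \<open>In contrast to \<open>mdp_prefix_prob_snoc\<close>, only the next-state factor is
  constant on the prefix event. The choice may depend on the sojourn times and remains inside
  \<open>joint_prob\<close>.\<close>

lemma (in scheduled_ma) ma_prefix_prob_snoc:
  "prefix_prob (ma_measure M \<sigma>) (untime M) (h @ [(s, a)]) =
    ennreal (pmf (next_state (underlying_mdp M) h) s) * joint_prob M \<sigma> h s a"
proof -
  let ?S = "{\<omega>. map (\<lambda>i. untime M (\<omega> i)) [0..<length h] = h}"
  have "prefix_prob (ma_measure M \<sigma>) (untime M) (h @ [(s, a)]) =
      (\<integral>\<^sup>+\<omega>. indicator ?S \<omega> * emeasure (ma_kernel M \<sigma> (length h) \<omega>) (untime M -` {(s, a)}) \<partial>ma_measure M \<sigma>)"
    using prefix_prob_step[OF untime_measurable, of M h "(s, a)"] by (simp add: ma_measure_def)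
  also have "\<dots> = (\<integral>\<^sup>+\<omega>. ennreal (pmf (next_state (underlying_mdp M) h) s) *
      (indicator ?S \<omega> * ennreal (label_prob M \<sigma> (map \<omega> [0..<length h], s) a)) \<partial>ma_measure M \<sigma>)"
    by (intro nn_integral_cong)
      (auto simp: emeasure_ma_kernel_untime ma_next_eq_next_state split: split_indicator)
  also have "\<dots> = ennreal (pmf (next_state (underlying_mdp M) h) s) * joint_prob M \<sigma> h s a"
    unfolding joint_prob_def by (rule nn_integral_cmult[OF joint_prob_integrand_measurable])
  finally show ?thesis .
qed

lemma (in scheduled_ma) ma_prefix_prob_Nil: "prefix_prob (ma_measure M \<sigma>) (untime M) [] = 1"
  unfolding ma_measure_def by (rule prefix_prob_Nil)

lemma (in scheduled_ma) ma_prefix_prob_finite: "prefix_prob (ma_measure M \<sigma>) (untime M) h \<noteq> \<infinity>"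
  unfolding prefix_prob_def ma_measure_def infinity_ennreal_def by (rule T.emeasure_finite)

text \<open>This normalises the averaged choices, and it bounds each \<open>joint_prob\<close> by
  the prefix probability, which settles the histories of probability zero.\<close>

lemma (in scheduled_ma) sum_joint_prob: "(\<Sum>a\<in>UNIV. joint_prob M \<sigma> h s a) = prefix_prob (ma_measure M \<sigma>) (untime M) h"
proof -
  have "(\<Sum>a\<in>UNIV. ennreal (label_prob M \<sigma> \<pi> a)) = 1" for \<pi>
    by (simp add: sum_ennreal label_prob_nonneg sum_label_prob)
  then show ?thesis
    unfolding joint_prob_def ma_prefix_prob_eq_integral
    by (subst nn_integral_sum[OF joint_prob_integrand_measurable, symmetric])
      (simp add: sum_distrib_left[symmetric])
qed

text \<open>A timed sequence above an untimed path need not be a path of the automaton, so the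
  integrand vanishes only almost everywhere: \<open>AE_wf_step\<close> discards the sequences on
  which \<open>\<sigma>\<close> is unconstrained.\<close>

lemma (in scheduled_ma) joint_prob_disabled:
  assumes path: "mdp_fpath (underlying_mdp M) (h, s)" and a: "a \<notin> ma_enabled M s"
  shows "joint_prob M \<sigma> h s a = 0"
proof -
  let ?n = "length h"
  have "AE \<omega> in ma_measure M \<sigma>. indicator {\<omega>. map (\<lambda>i. untime M (\<omega> i)) [0..<?n] = h} \<omega> *
     ennreal (label_prob M \<sigma> (map \<omega> [0..<?n], s) a) = 0"
    using AE_wf_step
  proof eventually_elim
    fix \<omega> :: "nat \<Rightarrow> 's \<times> ('a + real)" assume w: "\<forall>n. wf_step M (\<omega> n)"
    show "indicator {\<omega>. map (\<lambda>i. untime M (\<omega> i)) [0..<?n] = h} \<omega> *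
     ennreal (label_prob M \<sigma> (map \<omega> [0..<?n], s) a) = 0"
    proof (cases "map (\<lambda>i. untime M (\<omega> i)) [0..<?n] = h")
      case True
      have "label_prob M \<sigma> (map \<omega> [0..<?n], s) a = 0"
      proof (cases "s \<in> markov_states M")
        case s: True
        then have "bot_act M \<in> ma_enabled M s"
          by (auto simp: ma_enabled_def act_trans_def markov_states_def)
        with a s show ?thesis by (auto simp: label_prob_def indicator_def)
      next
        case False
        have "map (untime M) (map \<omega> [0..<?n]) = h" using True by (simp add: comp_def)
        with path have "mdp_fpath (underlying_mdp M) (map (untime M) (map \<omega> [0..<?n]), s)"
          by (simp only:)
        moreover have "\<forall>x\<in>set (map \<omega> [0..<?n]). wf_step M x"
          using w by simp
        ultimately have "ma_fpath M (map \<omega> [0..<?n], s)"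
          by (rule ma_fpath_of_mdp_fpath)
        moreover have "\<forall>\<pi>. ma_fpath M \<pi> \<longrightarrow> set_pmf (\<sigma> \<pi>) \<subseteq> ma_enabled M (snd \<pi>)"
          using \<sigma> unfolding ma_scheduler_def by (rule conjunct1)
        ultimately have "set_pmf (\<sigma> (map \<omega> [0..<?n], s)) \<subseteq> ma_enabled M s"
          by (metis snd_conv)
        with a False show ?thesis by (auto simp: label_prob_def pmf_eq_0_set_pmf)
      qed
      then show ?thesis by simp
    qed simp
  qed
  then show ?thesis
    unfolding joint_prob_def by (subst nn_integral_0_iff_AE[OF joint_prob_integrand_measurable])
qed

text \<open>The premise of \<open>step\<close> is the induction hypothesis. It is passed on so that
  a positive prefix probability in the automaton can be turned into one in the MDP, where it yields
  a path.\<close>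

lemma (in scheduled_ma) ma_reach_prob_eq_mdp_reach_prob:
  assumes step: "\<And>h s a. prefix_prob (ma_measure M \<sigma>) (untime M) h = prefix_prob (mdp_measure D \<sigma>') (\<lambda>x. x) h \<Longrightarrow>
      prefix_prob (ma_measure M \<sigma>) (untime M) (h @ [(s, a)]) =
      prefix_prob (ma_measure M \<sigma>) (untime M) h * ennreal (pmf (next_state D h) s) * ennreal (pmf (\<sigma>' (h, s)) a)"
  shows "ma_reach_prob M \<sigma> G = mdp_reach_prob D \<sigma>' G"
proof -
  have "prefix_prob (ma_measure M \<sigma>) (untime M) h = prefix_prob (mdp_measure D \<sigma>') (\<lambda>x. x) h" for h
  proof (induction h rule: rev_induct)
    case Nil
    show ?case by (simp only: ma_prefix_prob_Nil mdp_prefix_prob_Nil)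
  next
    case (snoc x h)
    show ?case by (cases x) (simp only: step[OF snoc] mdp_prefix_prob_snoc snoc)
  qed
  note eq = this[unfolded ma_measure_def mdp_measure_def]
  have "emeasure T {\<omega> \<in> space T. \<exists>i. untime M (\<omega> i) \<in> G \<times> UNIV} =
      emeasure (mdp_measure D \<sigma>') {\<omega> \<in> space (mdp_measure D \<sigma>'). \<exists>i. \<omega> i \<in> G \<times> UNIV}"
    unfolding mdp_measure_def
    by (rule reach_prob_eq[OF trajectory_axioms untime_measurable mdp.trajectory_axioms _ eq]) simp
  moreover have "(\<exists>i. untime M (\<omega> i) \<in> G \<times> UNIV) \<longleftrightarrow> reaches G \<omega>" for \<omega>
    by (simp add: reaches_def untime_conv)
  moreover have "(\<exists>i. \<omega> i \<in> G \<times> UNIV) \<longleftrightarrow> reaches G \<omega>" for \<omega> :: "nat \<Rightarrow> 's \<times> 'a"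
    by (simp add: reaches_def mem_Times_iff)
  ultimately show ?thesis
    by (simp only: ma_reach_prob_def mdp_reach_prob_def measure_def ma_measure_def)
qed

section \<open>From the automaton to the MDP: conditional expectation of the choices\<close>

text \<open>The first case concerns histories of probability zero, where any enabled action will do.\<close>

definition (in scheduled_ma) averaged_scheduler :: "('s, 'a) fpath \<Rightarrow> 'a pmf" where
  "averaged_scheduler = (\<lambda>(h, s). let q = prefix_prob (ma_measure M \<sigma>) (untime M) h in
     if q = 0 then return_pmf (SOME \<alpha>. \<alpha> \<in> ma_enabled M s)
     else embed_pmf (\<lambda>\<alpha>. enn2real (joint_prob M \<sigma> h s \<alpha> / q)))"

lemma (in scheduled_ma) pmf_averaged_scheduler:
  assumes q: "prefix_prob (ma_measure M \<sigma>) (untime M) h \<noteq> 0"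
  shows "ennreal (pmf (averaged_scheduler (h, s)) a) =
    joint_prob M \<sigma> h s a / prefix_prob (ma_measure M \<sigma>) (untime M) h"
proof -
  let ?q = "prefix_prob (ma_measure M \<sigma>) (untime M) h"
  have sum: "(\<Sum>\<alpha>\<in>UNIV. joint_prob M \<sigma> h s \<alpha> / ?q) = 1"
    unfolding divide_ennreal_def sum_distrib_right[symmetric] sum_joint_prob
    using q ma_prefix_prob_finite[of h]
    by (simp add: divide_ennreal_def[symmetric] ennreal_divide_self less_top)
  \<comment> \<open>Each quotient is a summand of a sum equal to 1, hence finite, so
    \<open>enn2real\<close> loses nothing.\<close>
  have "joint_prob M \<sigma> h s \<alpha> / ?q \<le> 1" for \<alpha>
    unfolding sum[symmetric] by (rule member_le_sum) auto
  then have fin: "ennreal (enn2real (joint_prob M \<sigma> h s \<alpha> / ?q)) = joint_prob M \<sigma> h s \<alpha> / ?q" for \<alpha>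
    by (intro ennreal_enn2real) (meson ennreal_one_less_top le_less_trans)
  have "(\<integral>\<^sup>+\<alpha>. ennreal (enn2real (joint_prob M \<sigma> h s \<alpha> / ?q)) \<partial>count_space UNIV) = 1"
    unfolding fin by (simp add: nn_integral_count_space_finite sum)
  then show ?thesis
    using q by (simp add: averaged_scheduler_def pmf_embed_pmf fin)
qed

lemma (in scheduled_ma) mdp_scheduler_averaged: "mdp_scheduler (underlying_mdp M) averaged_scheduler"
  unfolding mdp_scheduler_def
proof (intro allI impI)
  fix \<pi> assume path: "mdp_fpath (underlying_mdp M) \<pi>"
  obtain h s where \<pi>: "\<pi> = (h, s)" by (cases \<pi>)
  show "set_pmf (averaged_scheduler \<pi>) \<subseteq> mdp_enabled (underlying_mdp M) (snd \<pi>)"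
  proof (cases "prefix_prob (ma_measure M \<sigma>) (untime M) h = 0")
    case True
    \<comment> \<open>The absence of terminal states makes \<open>SOME\<close> pick an action that
      is indeed enabled.\<close>
    have "s \<in> prob_states M \<union> markov_states M" using wf by (simp add: ma_wf_def)
    then have "\<exists>\<alpha>. \<alpha> \<in> ma_enabled M s"
      by (auto simp: prob_states_def markov_states_def ma_enabled_def act_trans_def)
    then show ?thesis
      using True by (simp add: \<pi> averaged_scheduler_def enabled_underlying[OF wf] some_in_eq ex_in_conv)
  next
    case False
    have "\<alpha> \<in> ma_enabled M s" if "\<alpha> \<in> set_pmf (averaged_scheduler (h, s))" for \<alpha>
    proof (rule ccontr)
      assume "\<alpha> \<notin> ma_enabled M s"
      then have "ennreal (pmf (averaged_scheduler (h, s)) \<alpha>) = 0"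
        using path by (simp add: pmf_averaged_scheduler[OF False] joint_prob_disabled \<pi>)
      with that show False by (simp add: set_pmf_iff)
    qed
    then show ?thesis by (auto simp: \<pi> enabled_underlying[OF wf])
  qed
qed

lemma (in scheduled_ma) reach_prob_averaged_scheduler:
  "ma_reach_prob M \<sigma> G = mdp_reach_prob (underlying_mdp M) averaged_scheduler G"
proof (rule ma_reach_prob_eq_mdp_reach_prob)
  fix h s a
  let ?q = "prefix_prob (ma_measure M \<sigma>) (untime M) h"
  have "joint_prob M \<sigma> h s a = ?q * ennreal (pmf (averaged_scheduler (h, s)) a)"
  \<comment> \<open>Multiplying the quotient back by \<open>?q\<close> is legitimate only for
    nonzero \<open>?q\<close>. Otherwise \<open>joint_prob\<close> is at most \<open>?q\<close>, and
    both sides vanish.\<close>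
  proof (cases "?q = 0")
    case True
    have "joint_prob M \<sigma> h s a \<le> ?q"
      unfolding sum_joint_prob[of h s, symmetric] by (rule member_le_sum) auto
    with True show ?thesis by simp
  next
    case False
    then show ?thesis
      using ma_prefix_prob_finite[of h]
      by (simp add: pmf_averaged_scheduler ennreal_times_divide ennreal_mult_divide_eq mult.commute)
  qed
  then show "prefix_prob (ma_measure M \<sigma>) (untime M) (h @ [(s, a)]) =
      ?q * ennreal (pmf (next_state (underlying_mdp M) h) s) * ennreal (pmf (averaged_scheduler (h, s)) a)"
    by (simp add: ma_prefix_prob_snoc ac_simps)
qed

section \<open>From the MDP to the Markov automaton\<close>

definition time_oblivious ::
    "('s, 'a) ma \<Rightarrow> (('s, 'a) fpath \<Rightarrow> 'a pmf) \<Rightarrow> ('s, 'a + real) fpath \<Rightarrow> 'a pmf" where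
  "time_oblivious M \<sigma> \<pi> = \<sigma> (map (untime M) (fst \<pi>), snd \<pi>)"

locale scheduled_mdp =
  fixes M :: "('s::finite, 'a::finite) ma" and \<sigma> :: "('s, 'a) fpath \<Rightarrow> 'a pmf"
  assumes wf: "ma_wf M" and \<sigma>: "mdp_scheduler (underlying_mdp M) \<sigma>"
begin

abbreviation "\<tau> \<equiv> time_oblivious M \<sigma>"

lemma ma_scheduler_time_oblivious: "ma_scheduler M \<tau>"
  unfolding ma_scheduler_def
proof (intro conjI allI impI)
  fix \<pi> assume "ma_fpath M \<pi>"
  from mdp_fpath_of_ma_fpath[OF this] \<sigma> show "set_pmf (\<tau> \<pi>) \<subseteq> ma_enabled M (snd \<pi>)"
    unfolding mdp_scheduler_def time_oblivious_def by (force simp: enabled_underlying[OF wf])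
next
  fix n :: nat and s \<alpha>
  let ?X = "PiM {0..<n} (\<lambda>_. ma_step_space :: ('s \<times> ('a + real)) measure)"
  have "(\<lambda>\<omega>. map (\<lambda>i. untime M (\<omega> i)) [0..<n]) \<in> measurable ?X (count_space UNIV)"
    \<comment> \<open>There are only countably many lists over a finite type, so it suffices to
      consider preimages of single lists.\<close>
    unfolding measurable_count_space_eq2_countable
    using map_prefix_measurable[OF untime_measurable order_refl, of n M]
    by (auto simp: vimage_def Int_def conj_commute)
  from measurable_compose[OF this, of "\<lambda>h. pmf (\<sigma> (h, s)) \<alpha>" borel]
  show "(\<lambda>\<omega>. pmf (\<tau> (map \<omega> [0..<n], s)) \<alpha>) \<in> borel_measurable ?X"
    by (simp add: time_oblivious_def comp_def)
qed

text \<open>By maximal progress \<open>bot_act M\<close> is the only enabled action at a Markov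
  state, so on a path the MDP scheduler must choose it with probability one, just as untiming a
  delay does.\<close>

lemma label_prob_time_oblivious:
  assumes "mdp_fpath (underlying_mdp M) (map (untime M) h, s)"
  shows "label_prob M \<tau> (h, s) a = pmf (\<sigma> (map (untime M) h, s)) a"
proof (cases "s \<in> markov_states M")
  case True
  then have "s \<notin> prob_states M" using wf unfolding ma_wf_def by blast
  then have "ma_enabled M s \<subseteq> {bot_act M}"
    by (auto simp: ma_enabled_def act_trans_def prob_states_def)
  moreover have "set_pmf (\<sigma> (map (untime M) h, s)) \<subseteq> ma_enabled M s"
    using \<sigma> assms unfolding mdp_scheduler_def enabled_underlying[OF wf] by (metis snd_conv)
  ultimately have "\<sigma> (map (untime M) h, s) = return_pmf (bot_act M)"
    unfolding set_pmf_subset_singleton[symmetric] by (rule subset_trans[rotated])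
  then show ?thesis using True by (simp add: label_prob_def pmf_return indicator_def)
qed (simp add: label_prob_def time_oblivious_def)

end

sublocale scheduled_mdp \<subseteq> ma: scheduled_ma M \<tau>
  by (rule scheduled_ma.intro[OF wf ma_scheduler_time_oblivious])

lemma (in scheduled_mdp) joint_prob_time_oblivious:
  assumes path: "mdp_fpath (underlying_mdp M) (h, s)"
  shows "joint_prob M \<tau> h s a = prefix_prob (ma_measure M \<tau>) (untime M) h * ennreal (pmf (\<sigma> (h, s)) a)"
proof -
  let ?S = "{\<omega>. map (\<lambda>i. untime M (\<omega> i)) [0..<length h] = h}"
  have lp: "label_prob M \<tau> (map \<omega> [0..<length h], s) a = pmf (\<sigma> (h, s)) a" if "\<omega> \<in> ?S" for \<omega>
  proof -
    have "map (untime M) (map \<omega> [0..<length h]) = h" using that by (simp add: comp_def)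
    with label_prob_time_oblivious[of "map \<omega> [0..<length h]" s a] path show ?thesis by (simp only:)
  qed
  have "joint_prob M \<tau> h s a = (\<integral>\<^sup>+\<omega>. indicator ?S \<omega> * ennreal (pmf (\<sigma> (h, s)) a) \<partial>ma_measure M \<tau>)"
    unfolding joint_prob_def by (intro nn_integral_cong) (auto simp: lp split: split_indicator)
  also have "\<dots> = prefix_prob (ma_measure M \<tau>) (untime M) h * ennreal (pmf (\<sigma> (h, s)) a)"
    unfolding ma.ma_prefix_prob_eq_integral using ma.ma_prefix_set(2) by (intro nn_integral_multc) simp
  finally show ?thesis .
qed

lemma (in scheduled_mdp) reach_prob_time_oblivious:
  "ma_reach_prob M \<tau> G = mdp_reach_prob (underlying_mdp M) \<sigma> G"
proof (rule ma.ma_reach_prob_eq_mdp_reach_prob)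
  fix h s a
  let ?q = "prefix_prob (ma_measure M \<tau>) (untime M) h" and ?n = "pmf (next_state (underlying_mdp M) h) s"
  assume q: "?q = prefix_prob (mdp_measure (underlying_mdp M) \<sigma>) (\<lambda>x. x) h"
  show "prefix_prob (ma_measure M \<tau>) (untime M) (h @ [(s, a)]) =
      ?q * ennreal ?n * ennreal (pmf (\<sigma> (h, s)) a)"
  \<comment> \<open>If either factor is zero, both sides vanish. Otherwise \<open>q\<close> moves
    positivity to the MDP measure, which makes \<open>(h, s)\<close> a path, and only on paths does
    the choice factor out of \<open>joint_prob\<close>.\<close>
  proof (cases "?q = 0 \<or> ?n = 0")
    case True
    have "joint_prob M \<tau> h s a \<le> ?q"
      unfolding ma.sum_joint_prob[of h s, symmetric] by (rule member_le_sum) auto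
    with True show ?thesis by (auto simp: ma.ma_prefix_prob_snoc)
  next
    case False
    then have "mdp_fpath (underlying_mdp M) (h, s)"
      unfolding q by (intro mdp_fpath_of_prefix_prob[OF is_mdp_underlying[OF wf] \<sigma>]) auto
    then show ?thesis by (simp add: ma.ma_prefix_prob_snoc joint_prob_time_oblivious ac_simps)
  qed
qed

theorem theorem3:
  fixes M :: "('s::finite, 'a::finite) ma"
    and d :: nat
    and G :: "nat \<Rightarrow> 's set"
    and rel :: "nat \<Rightarrow> real \<Rightarrow> real \<Rightarrow> bool"
    and p :: "nat \<Rightarrow> real"
  assumes "markov_automaton M"
    and "\<forall>i\<in>{1..d}. rel i \<in> {(<), (\<le>), (>), (\<ge>)}"
  shows "ma_achieve M d G rel p \<longleftrightarrow> mdp_achieve (underlying_mdp M) d G rel p"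
proof -
  have wf: "ma_wf M" using assms(1) by (simp add: markov_automaton_def)
  show ?thesis
  proof
    assume "ma_achieve M d G rel p"
    then obtain \<sigma> where sched: "ma_scheduler M \<sigma>"
        and reach: "\<forall>i\<in>{1..d}. rel i (ma_reach_prob M \<sigma> (G i)) (p i)"
      unfolding ma_achieve_def by blast
    interpret scheduled_ma M \<sigma> by (rule scheduled_ma.intro[OF wf sched])
    show "mdp_achieve (underlying_mdp M) d G rel p"
      using reach mdp_scheduler_averaged unfolding mdp_achieve_def reach_prob_averaged_scheduler by blast
  next
    assume "mdp_achieve (underlying_mdp M) d G rel p"
    then obtain \<sigma> where sched: "mdp_scheduler (underlying_mdp M) \<sigma>"
        and reach: "\<forall>i\<in>{1..d}. rel i (mdp_reach_prob (underlying_mdp M) \<sigma> (G i)) (p i)"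
      unfolding mdp_achieve_def by blast
    interpret scheduled_mdp M \<sigma> by (rule scheduled_mdp.intro[OF wf sched])
    show "ma_achieve M d G rel p"
      using reach ma_scheduler_time_oblivious
      unfolding ma_achieve_def reach_prob_time_oblivious[symmetric] by blast
  qed
qed

end
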